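(* Let $\mathcal{L}=(L,\prec_{\mathcal{L}})$ be a computable linear order, and let $C\subseteq\mathbb{N}$ be co-c.e. and cohesive. Then the finite condensation $c_F(\Pi_C\mathcal{L})$ is dense, i.e., for any two of its elements $I<J$ there is an element $K$ with $I<K<J$.
   Context: A set $C\subseteq\mathbb{N}$ is cohesive if it is infinite and for every c.e. set $W$, either $C\setminus W$ or $C\cap W$ is finite; co-c.e. means $\mathbb{N}\setminus C$ is c.e. Write $X\subseteq^* Y$ if $X\setminus Y$ is finite. For a computable linear order $\mathcal{L}=(L,\prec_{\mathcal{L}})$, the cohesive power $\Pi_C\mathcal{L}$ has as elements the classes $[\varphi]$ of partial computable $\varphi\colon\mathbb{N}\to L$ with $C\subseteq^*\mathrm{dom}(\varphi)$ under $\varphi=_C\psi$ iff $C\subseteq^*\{x:\varphi(x)\downarrow=\psi(x)\downarrow\}$, ordered by $[\varphi]\prec[\psi]$ iff $C\subseteq^*\{x:\varphi(x)\downarrow,\psi(x)\downarrow,\varphi(x)\prec_{\mathcal{L}}\psi(x)\}$. For a linear order $\mathcal{M}$ and element $x$, $c_F(x)$ is the set of $y$ such that the closed interval between $x$ and $y$ is finite; these sets partition $\mathcal{M}$ into intervals (blocks), and the finite condensation $c_F(\mathcal{M})$ is the set of blocks ordered by $I<J$ iff every element of $I$ is below every element of $J$. *)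

theory Defs
  imports Main
begin

section \<open>Partial recursive functions\<close>

text \<open>
  Kleene's schemes. Arity is not tracked: a term applied to an argument list of unsuitable
  length is undefined (\<open>None\<close>), so on lists of any fixed length a term still denotes a
  partial recursive function. \<open>Zero\<close> is the constant zero function in every arity;
  \<open>PrimRec\<close> recurses on, and \<open>Mu\<close> minimises over, the first argument. In
  \<open>PrimRec f g\<close> the step function \<open>g\<close> receives the previous value first, then
  the recursion counter, then the parameters.
\<close>

datatype recf =
    Zero
  | Succ
  | Proj nat
  | Comp recf "recf list"
  | PrimRec recf recf
  | Mu recf

fun eval :: "recf \<Rightarrow> nat list \<Rightarrow> nat option" where
  "eval Zero xs = Some 0"
| "eval Succ xs = (case xs of [x] \<Rightarrow> Some (Suc x) | _ \<Rightarrow> None)"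
| "eval (Proj i) xs = (if i < length xs then Some (xs ! i) else None)"
| "eval (Comp f gs) xs =
     (if \<exists>g\<in>set gs. eval g xs = None then None
      else eval f (map (\<lambda>g. the (eval g xs)) gs))"
| "eval (PrimRec f g) xs =
     (case xs of
        [] \<Rightarrow> None
      | n # ys \<Rightarrow>
          rec_nat (eval f ys) (\<lambda>k r. Option.bind r (\<lambda>y. eval g (y # k # ys))) n)"
| "eval (Mu f) xs =
     (if \<exists>n. eval f (n # xs) = Some 0 \<and> (\<forall>m<n. eval f (m # xs) \<noteq> None)
      then Some (LEAST n. eval f (n # xs) = Some 0)
      else None)"

definition partial_computable :: "(nat \<rightharpoonup> nat) \<Rightarrow> bool" where
  "partial_computable \<phi> \<longleftrightarrow> (\<exists>f. \<forall>x. \<phi> x = eval f [x])"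

definition ce_set :: "nat set \<Rightarrow> bool" where
  "ce_set W \<longleftrightarrow> (\<exists>\<phi>. partial_computable \<phi> \<and> W = dom \<phi>)"

definition computable_set :: "nat set \<Rightarrow> bool" where
  "computable_set A \<longleftrightarrow> (\<exists>f. \<forall>x. eval f [x] = Some (if x \<in> A then 1 else 0))"

definition computable_rel :: "nat rel \<Rightarrow> bool" where
  "computable_rel r \<longleftrightarrow> (\<exists>f. \<forall>x y. eval f [x, y] = Some (if (x, y) \<in> r then 1 else 0))"

definition computable_linear_order :: "nat set \<Rightarrow> nat rel \<Rightarrow> bool" where
  "computable_linear_order L r \<longleftrightarrow>
     computable_set L \<and> computable_rel r \<and> r \<subseteq> L \<times> L \<and> strict_linear_order_on L r"


section \<open>Cohesive sets and cohesive powers\<close>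

definition almost_subset :: "'a set \<Rightarrow> 'a set \<Rightarrow> bool" (infix \<open>\<subseteq>*\<close> 50) where
  "X \<subseteq>* Y \<longleftrightarrow> finite (X - Y)"

definition cohesive :: "nat set \<Rightarrow> bool" where
  "cohesive C \<longleftrightarrow> infinite C \<and> (\<forall>W. ce_set W \<longrightarrow> finite (C - W) \<or> finite (C \<inter> W))"

definition co_ce :: "nat set \<Rightarrow> bool" where
  "co_ce C \<longleftrightarrow> ce_set (- C)"

definition cp_functions :: "nat set \<Rightarrow> nat set \<Rightarrow> (nat \<rightharpoonup> nat) set" where
  "cp_functions C L = {\<phi>. partial_computable \<phi> \<and> ran \<phi> \<subseteq> L \<and> C \<subseteq>* dom \<phi>}"

definition cp_eq :: "nat set \<Rightarrow> nat set \<Rightarrow> (nat \<rightharpoonup> nat) rel" where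
  "cp_eq C L = {(\<phi>, \<psi>). \<phi> \<in> cp_functions C L \<and> \<psi> \<in> cp_functions C L \<and>
     C \<subseteq>* {x. \<exists>a. \<phi> x = Some a \<and> \<psi> x = Some a}}"

definition cp_class :: "nat set \<Rightarrow> nat set \<Rightarrow> (nat \<rightharpoonup> nat) \<Rightarrow> (nat \<rightharpoonup> nat) set" where
  "cp_class C L \<phi> = cp_eq C L `` {\<phi>}"

definition cohesive_power :: "nat set \<Rightarrow> nat set \<Rightarrow> (nat \<rightharpoonup> nat) set set" where
  "cohesive_power C L = cp_functions C L // cp_eq C L"

definition cp_less :: "nat set \<Rightarrow> nat set \<Rightarrow> nat rel \<Rightarrow> (nat \<rightharpoonup> nat) set rel" where
  "cp_less C L r = {(cp_class C L \<phi>, cp_class C L \<psi>) | \<phi> \<psi>.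
     \<phi> \<in> cp_functions C L \<and> \<psi> \<in> cp_functions C L \<and>
     C \<subseteq>* {x. \<exists>a b. \<phi> x = Some a \<and> \<psi> x = Some b \<and> (a, b) \<in> r}}"

lemma almost_subset_Int_mono:
  assumes "C \<subseteq>* A" "C \<subseteq>* B" "A \<inter> B \<subseteq> D"
  shows "C \<subseteq>* D"
proof -
  have "C - D \<subseteq> (C - A) \<union> (C - B)" using assms(3) by blast
  then show ?thesis
    using assms(1,2) by (auto simp: almost_subset_def intro: finite_subset)
qed

lemma equiv_cp_eq: "equiv (cp_functions C L) (cp_eq C L)"
proof (rule equivI)
  show "cp_eq C L \<subseteq> cp_functions C L \<times> cp_functions C L"
    by (auto simp: cp_eq_def)
  show "refl_on (cp_functions C L) (cp_eq C L)"
    by (auto simp: refl_on_def cp_eq_def cp_functions_def dom_def)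
  show "sym (cp_eq C L)"
    by (auto simp: sym_def cp_eq_def conj_commute)
  show "trans (cp_eq C L)"
  proof (rule transI)
    let ?E = "\<lambda>\<phi> \<psi>. {x. \<exists>a. \<phi> x = Some a \<and> \<psi> x = Some (a :: nat)}"
    fix \<phi> \<psi> \<chi>
    assume *: "(\<phi>, \<psi>) \<in> cp_eq C L" "(\<psi>, \<chi>) \<in> cp_eq C L"
    then have "C \<subseteq>* ?E \<phi> \<psi>" "C \<subseteq>* ?E \<psi> \<chi>"
      by (auto simp: cp_eq_def)
    then have "C \<subseteq>* ?E \<phi> \<chi>"
      by (rule almost_subset_Int_mono) auto
    with * show "(\<phi>, \<chi>) \<in> cp_eq C L"
      by (simp add: cp_eq_def)
  qed
qed

text \<open>The order on classes does not depend on the representatives.\<close>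

lemma cp_less_iff:
  assumes "\<phi> \<in> cp_functions C L" "\<psi> \<in> cp_functions C L"
  shows "(cp_class C L \<phi>, cp_class C L \<psi>) \<in> cp_less C L r \<longleftrightarrow>
    C \<subseteq>* {x. \<exists>a b. \<phi> x = Some a \<and> \<psi> x = Some b \<and> (a, b) \<in> r}"
    (is "?l \<longleftrightarrow> C \<subseteq>* ?D \<phi> \<psi>")
proof
  assume "C \<subseteq>* ?D \<phi> \<psi>"
  then show ?l using assms by (auto simp: cp_less_def)
next
  let ?E = "\<lambda>\<phi> \<psi>. {x. \<exists>a. \<phi> x = Some a \<and> \<psi> x = Some (a :: nat)}"
  assume ?l
  then obtain \<phi>' \<psi>' where *: "cp_class C L \<phi> = cp_class C L \<phi>'" "cp_class C L \<psi> = cp_class C L \<psi>'"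
      "\<phi>' \<in> cp_functions C L" "\<psi>' \<in> cp_functions C L" "C \<subseteq>* ?D \<phi>' \<psi>'"
    by (auto simp: cp_less_def)
  have "(\<phi>, \<phi>') \<in> cp_eq C L" "(\<psi>, \<psi>') \<in> cp_eq C L"
    using * assms eq_equiv_class[OF _ equiv_cp_eq] unfolding cp_class_def by blast+
  then have E: "C \<subseteq>* ?E \<phi> \<phi>'" "C \<subseteq>* ?E \<psi> \<psi>'"
    by (auto simp: cp_eq_def)
  have "C \<subseteq>* ?E \<phi> \<phi>' \<inter> ?E \<psi> \<psi>'"
    using E by (rule almost_subset_Int_mono) simp
  then show "C \<subseteq>* ?D \<phi> \<psi>"
    using *(5) by (rule almost_subset_Int_mono) auto
qed


section \<open>The finite condensation\<close>

text \<open>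
  A linear order is given by its carrier \<open>M\<close> and its strict order relation \<open>r\<close>;
  the set \<open>closed_between M r x y\<close> is \<open>[x, y]\<close> or \<open>[y, x]\<close>, whichever
  of \<open>x\<close>, \<open>y\<close> is the smaller.
\<close>

definition closed_between :: "'a set \<Rightarrow> 'a rel \<Rightarrow> 'a \<Rightarrow> 'a \<Rightarrow> 'a set" where
  "closed_between M r x y =
     {z \<in> M. (x, z) \<in> r\<^sup>= \<and> (z, y) \<in> r\<^sup>= \<or> (y, z) \<in> r\<^sup>= \<and> (z, x) \<in> r\<^sup>=}"

definition block :: "'a set \<Rightarrow> 'a rel \<Rightarrow> 'a \<Rightarrow> 'a set" where
  "block M r x = {y \<in> M. finite (closed_between M r x y)}"

definition finite_condensation :: "'a set \<Rightarrow> 'a rel \<Rightarrow> 'a set set" where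
  "finite_condensation M r = block M r ` M"

definition block_less :: "'a rel \<Rightarrow> 'a set \<Rightarrow> 'a set \<Rightarrow> bool" where
  "block_less r I J \<longleftrightarrow> (\<forall>x\<in>I. \<forall>y\<in>J. (x, y) \<in> r)"

definition dense_on :: "'a set \<Rightarrow> ('a \<Rightarrow> 'a \<Rightarrow> bool) \<Rightarrow> bool" where
  "dense_on A lt \<longleftrightarrow> (\<forall>I\<in>A. \<forall>J\<in>A. lt I J \<longrightarrow> (\<exists>K\<in>A. lt I K \<and> lt K J))"

end

theory Submission
  imports Defs HOL.Filter
begin

text \<open>
  Two elements \<open>[\<phi>] \<prec> [\<psi>]\<close> of the cohesive power lie in different blocks exactly if, for
  every \<open>k\<close>, the interval between \<open>\<phi> x\<close> and \<open>\<psi> x\<close> has at least \<open>k\<close> elements for almost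
  all \<open>x \<in> C\<close>. To find \<open>[\<theta>]\<close> far from both, one needs \<open>\<theta> x\<close> to be about the middle of the part
  of this interval enumerated by some stage, with no computable bound telling how long to wait.
  As \<open>C\<close> is co-c.e., the least \<open>x \<ge> k\<close> in \<open>C\<close> whose interval has at least \<open>2 * k + 1\<close> elements
  can be guessed stagewise, and the guesses for \<open>k\<close> converge. Let \<open>\<theta>\<close> be defined at every
  \<open>x\<close> that is ever guessed for some \<open>k\<close>. Only finitely many \<open>x\<close> are
  guessed for each \<open>k\<close>, so both distances tend to infinity along \<open>C\<close>. The domain of \<open>\<theta>\<close> is c.e. and
  contains infinitely many elements of \<open>C\<close>, namely the limits of the guesses, hence almost all
  of them by cohesiveness.
\<close>

section \<open>Total computable functions and decidable relations\<close>

text \<open>Kleene terms carry no arity, so \<open>n\<close> fixes the length of the argument lists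
  on which the term has to produce \<open>F\<close>.\<close>

definition total_computable :: "nat \<Rightarrow> (nat list \<Rightarrow> nat) \<Rightarrow> bool" where
  "total_computable n F \<longleftrightarrow> (\<exists>f. \<forall>xs. length xs = n \<longrightarrow> eval f xs = Some (F xs))"

definition decidable :: "nat \<Rightarrow> (nat list \<Rightarrow> bool) \<Rightarrow> bool" where
  "decidable n P \<longleftrightarrow> total_computable n (\<lambda>xs. of_bool (P xs))"

named_theorems computable_intros

lemma total_computable_cong:
  assumes "total_computable n F" "\<And>xs. length xs = n \<Longrightarrow> F xs = G xs"
  shows "total_computable n G"
  using assms by (auto simp: total_computable_def)

lemma total_computable_compose:
  assumes "total_computable (length Gs) F" "\<And>G. G \<in> set Gs \<Longrightarrow> total_computable n G"
  shows "total_computable n (\<lambda>xs. F (map (\<lambda>G. G xs) Gs))"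
proof -
  obtain f where f: "\<And>xs. length xs = length Gs \<Longrightarrow> eval f xs = Some (F xs)"
    using assms(1) by (auto simp: total_computable_def)
  have "\<forall>G\<in>set Gs. \<exists>g. \<forall>xs. length xs = n \<longrightarrow> eval g xs = Some (G xs)"
    using assms(2) by (auto simp: total_computable_def)
  then obtain g where g: "\<And>G xs. G \<in> set Gs \<Longrightarrow> length xs = n \<Longrightarrow> eval (g G) xs = Some (G xs)"
    by metis
  have "eval (Comp f (map g Gs)) xs = Some (F (map (\<lambda>G. G xs) Gs))" if "length xs = n" for xs
  proof -
    have "map (\<lambda>h. the (eval h xs)) (map g Gs) = map (\<lambda>G. G xs) Gs"
      using g that by auto
    then show ?thesis using g f that by (simp del: map_map)
  qed
  then show ?thesis unfolding total_computable_def by blast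
qed

lemma total_computable_nth [computable_intros]:
  "i < n \<Longrightarrow> total_computable n (\<lambda>xs. xs ! i)"
  unfolding total_computable_def by (rule exI[of _ "Proj i"]) simp

text \<open>Recursion, sums and bounded quantifiers put the bound variable at the head of the
  argument list; expressions in the outer parameters then act on the tail.\<close>

lemma total_computable_tl [computable_intros]:
  assumes "total_computable n F"
  shows "total_computable (Suc n) (\<lambda>xs. F (tl xs))"
proof -
  let ?Gs = "map (\<lambda>i xs. xs ! Suc i) [0..<n]"
  have "total_computable (Suc n) (\<lambda>xs. F (map (\<lambda>G. G xs) ?Gs))"
    by (rule total_computable_compose) (use assms in \<open>auto intro: total_computable_nth\<close>)
  then show ?thesis
    by (rule total_computable_cong)
       (auto intro!: arg_cong[of _ _ F] nth_equalityI simp: nth_tl)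
qed

lemma total_computable_Suc [computable_intros]:
  assumes "total_computable n F"
  shows "total_computable n (\<lambda>xs. Suc (F xs))"
proof -
  have "total_computable 1 (\<lambda>xs. Suc (xs ! 0))"
    unfolding total_computable_def
    by (rule exI[of _ Succ]) (auto simp: length_Suc_conv)
  then show ?thesis
    using total_computable_compose[of "[F]" "\<lambda>xs. Suc (xs ! 0)" n] assms by simp
qed

lemma total_computable_const [computable_intros]: "total_computable n (\<lambda>_. c)"
proof (induction c)
  case 0
  show ?case unfolding total_computable_def by (rule exI[of _ Zero]) simp
qed (rule total_computable_Suc)

text \<open>\<open>PrimRec\<close> recurses on the head of its argument list. So the recursion is
  first obtained with its bound as an extra leading argument, and composition with \<open>B\<close>
  and the projections then supplies that bound.\<close>

lemma total_computable_rec_nat [computable_intros]: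
  assumes "total_computable n B" "total_computable n F"
    "total_computable (Suc (Suc n)) (\<lambda>ys. G (ys ! 0) (ys ! 1) (tl (tl ys)))"
  shows "total_computable n (\<lambda>xs. rec_nat (F xs) (\<lambda>k y. G y k xs) (B xs))"
proof -
  obtain f where f: "\<And>xs. length xs = n \<Longrightarrow> eval f xs = Some (F xs)"
    using assms(2) by (auto simp: total_computable_def)
  obtain g where g: "\<And>y k xs. length xs = n \<Longrightarrow> eval g (y # k # xs) = Some (G y k xs)"
    using assms(3) unfolding total_computable_def
    by (metis length_Cons list.sel(3) nth_Cons_0 One_nat_def nth_Cons_Suc)
  have "rec_nat (eval f ys) (\<lambda>k r. Option.bind r (\<lambda>y. eval g (y # k # ys))) m
      = Some (rec_nat (F ys) (\<lambda>k y. G y k ys) m)" if "length ys = n" for ys m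
    by (induction m) (use that f g in auto)
  then have "total_computable (Suc n) (\<lambda>xs. rec_nat (F (tl xs)) (\<lambda>k y. G y k (tl xs)) (xs ! 0))"
    unfolding total_computable_def
    by (intro exI[of _ "PrimRec f g"]) (auto simp: length_Suc_conv)
  then have "total_computable (length (B # map (\<lambda>i xs. xs ! i) [0..<n]))
      (\<lambda>xs. rec_nat (F (tl xs)) (\<lambda>k y. G y k (tl xs)) (xs ! 0))" by simp
  then have "total_computable n (\<lambda>xs. (\<lambda>xs. rec_nat (F (tl xs)) (\<lambda>k y. G y k (tl xs)) (xs ! 0))
      (map (\<lambda>G. G xs) (B # map (\<lambda>i xs. xs ! i) [0..<n])))"
    by (rule total_computable_compose) (auto intro: total_computable_nth assms(1))
  then have "total_computable n (\<lambda>xs. rec_nat (F (map (\<lambda>i. xs ! i) [0..<n]))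
      (\<lambda>k y. G y k (map (\<lambda>i. xs ! i) [0..<n])) (B xs))"
    by (simp add: comp_def)
  then show ?thesis
    by (rule total_computable_cong) (auto simp: map_nth)
qed

section \<open>Arithmetic, bounded sums and products\<close>

lemma total_computable_add [computable_intros]:
  assumes "total_computable n F" "total_computable n G"
  shows "total_computable n (\<lambda>xs. F xs + G xs)"
proof -
  have "rec_nat a (\<lambda>k y. Suc y) b = a + b" for a b :: nat by (induction b) auto
  moreover have "total_computable n (\<lambda>xs. rec_nat (F xs) (\<lambda>k y. Suc y) (G xs))"
    by (intro computable_intros assms) simp
  ultimately show ?thesis by simp
qed

lemma total_computable_diff [computable_intros]:
  assumes "total_computable n F" "total_computable n G"
  shows "total_computable n (\<lambda>xs. F xs - G xs)"
proof -
  \<comment> \<open>The predecessor is a recursion that discards the previous value and returns the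
    counter.\<close>
  have pred: "rec_nat 0 (\<lambda>k y. k) b = b - 1" for b :: nat by (cases b) auto
  have "total_computable (Suc (Suc n)) (\<lambda>ys. rec_nat 0 (\<lambda>k y. k) (ys ! 0))"
    by (intro computable_intros) simp_all
  then have "total_computable n (\<lambda>xs. rec_nat (F xs) (\<lambda>k y. y - 1) (G xs))"
    unfolding pred by (intro total_computable_rec_nat assms)
  moreover have "rec_nat a (\<lambda>k y. y - 1) b = a - b" for a b :: nat by (induction b) auto
  ultimately show ?thesis by simp
qed

lemma total_computable_sum [computable_intros]:
  assumes "total_computable n B" "total_computable (Suc n) (\<lambda>ys. F (ys ! 0) (tl ys))"
  shows "total_computable n (\<lambda>xs. \<Sum>i<B xs. F i xs)"
proof -
  have "total_computable (Suc (Suc n)) (\<lambda>ys. F (tl ys ! 0) (tl (tl ys)))"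
    using total_computable_tl[OF assms(2)] .
  then have "total_computable (Suc (Suc n)) (\<lambda>ys. F (ys ! 1) (tl (tl ys)))"
    by (rule total_computable_cong) (auto simp: nth_tl)
  then have "total_computable n (\<lambda>xs. rec_nat 0 (\<lambda>k y. y + F k xs) (B xs))"
    by (intro computable_intros assms) simp_all
  moreover have "rec_nat 0 (\<lambda>k y. y + F k xs) b = (\<Sum>i<b. F i xs)" for b xs
    by (induction b) auto
  ultimately show ?thesis by simp
qed

lemma total_computable_mult [computable_intros]:
  assumes "total_computable n F" "total_computable n G"
  shows "total_computable n (\<lambda>xs. F xs * G xs)"
proof -
  have "total_computable n (\<lambda>xs. \<Sum>i<F xs. G xs)"
    by (intro computable_intros assms)
  then show ?thesis by simp
qed

section \<open>Closure properties of decidable relations\<close>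

lemma total_computable_of_bool [computable_intros]:
  "decidable n P \<Longrightarrow> total_computable n (\<lambda>xs. of_bool (P xs))"
  by (simp add: decidable_def)

lemma decidable_cong:
  assumes "decidable n P" "\<And>xs. length xs = n \<Longrightarrow> P xs = Q xs"
  shows "decidable n Q"
  using assms unfolding decidable_def by (auto intro: total_computable_cong)

lemma decidable_tl [computable_intros]:
  "decidable n P \<Longrightarrow> decidable (Suc n) (\<lambda>xs. P (tl xs))"
  unfolding decidable_def by (rule total_computable_tl)

text \<open>Approximations expect the stage first, while a binder puts its variable in front of the
  stage; exchanging the two entries reconciles the conventions.\<close>

lemma total_computable_swap:
  assumes "total_computable (Suc (Suc n)) T"
  shows "total_computable (Suc (Suc n)) (\<lambda>zs. T (tl zs ! 0 # zs ! 0 # tl (tl zs)))"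
proof -
  let ?Gs = "(\<lambda>zs. zs ! 1) # (\<lambda>zs. zs ! 0) # map (\<lambda>i zs. zs ! (i + 2)) [0..<n]"
  have "total_computable (Suc (Suc n)) (\<lambda>zs. T (map (\<lambda>G. G zs) ?Gs))"
    by (rule total_computable_compose) (use assms in \<open>auto intro!: computable_intros\<close>)
  then show ?thesis
    by (rule total_computable_cong)
       (auto intro!: arg_cong[of _ _ T] nth_equalityI simp: nth_tl numeral_eq_Suc length_Suc_conv)
qed

lemma decidable_compose:
  assumes "decidable (length Gs) P" "\<And>G. G \<in> set Gs \<Longrightarrow> total_computable n G"
  shows "decidable n (\<lambda>xs. P (map (\<lambda>G. G xs) Gs))"
  unfolding decidable_def
  by (rule total_computable_compose) (use assms in \<open>auto simp: decidable_def\<close>)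

lemma decidable_not [computable_intros]:
  assumes "decidable n P"
  shows "decidable n (\<lambda>xs. \<not> P xs)"
proof -
  have "total_computable n (\<lambda>xs. 1 - of_bool (P xs))"
    by (intro computable_intros assms)
  then show ?thesis unfolding decidable_def by (rule total_computable_cong) simp
qed

lemma decidable_conj [computable_intros]:
  assumes "decidable n P" "decidable n Q"
  shows "decidable n (\<lambda>xs. P xs \<and> Q xs)"
proof -
  have "total_computable n (\<lambda>xs. of_bool (P xs) * of_bool (Q xs))"
    by (intro computable_intros assms)
  then show ?thesis unfolding decidable_def by (rule total_computable_cong) simp
qed

lemma decidable_le [computable_intros]:
  assumes "total_computable n F" "total_computable n G"
  shows "decidable n (\<lambda>xs. F xs \<le> G xs)"
proof -
  have "total_computable n (\<lambda>xs. 1 - (F xs - G xs))"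
    by (intro computable_intros assms)
  then show ?thesis unfolding decidable_def by (rule total_computable_cong) auto
qed

lemma decidable_less [computable_intros]:
  assumes "total_computable n F" "total_computable n G"
  shows "decidable n (\<lambda>xs. F xs < G xs)"
  using decidable_le[OF total_computable_Suc[OF assms(1)] assms(2)] by (simp add: Suc_le_eq)

lemma decidable_eq [computable_intros]:
  assumes "total_computable n F" "total_computable n G"
  shows "decidable n (\<lambda>xs. F xs = G xs)"
  unfolding order_eq_iff by (intro computable_intros assms)

lemma decidable_ex_less [computable_intros]:
  assumes "total_computable n B" "decidable (Suc n) (\<lambda>ys. P (ys ! 0) (tl ys))"
  shows "decidable n (\<lambda>xs. \<exists>i<B xs. P i xs)"
proof -
  have "decidable n (\<lambda>xs. (0::nat) < (\<Sum>i<B xs. of_bool (P i xs)))"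
    by (intro computable_intros assms)
  then show ?thesis
    by (rule decidable_cong) (auto simp: sum_pos2 simp flip: neq0_conv)
qed

lemma decidable_all_less [computable_intros]:
  assumes "total_computable n B" "decidable (Suc n) (\<lambda>ys. P (ys ! 0) (tl ys))"
  shows "decidable n (\<lambda>xs. \<forall>i<B xs. P i xs)"
proof -
  have "decidable n (\<lambda>xs. \<not> (\<exists>i<B xs. \<not> P i xs))"
    by (intro computable_intros assms)
  then show ?thesis by simp
qed

lemma total_computable_card [computable_intros]:
  assumes "total_computable n B" "decidable (Suc n) (\<lambda>ys. P (ys ! 0) (tl ys))"
  shows "total_computable n (\<lambda>xs. card {i. i < B xs \<and> P i xs})"
proof -
  have "total_computable n (\<lambda>xs. \<Sum>i<B xs. of_bool (P i xs))"
    by (intro computable_intros assms)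
  moreover have "(\<Sum>i<b. of_bool (Q i)) = card {i. i < b \<and> Q i}" for b :: nat and Q
    by (simp add: lessThan_def Int_def)
  ultimately show ?thesis by simp
qed

lemma computable_rel_decidable [computable_intros]:
  assumes "computable_rel r" "total_computable n F" "total_computable n G"
  shows "decidable n (\<lambda>xs. (F xs, G xs) \<in> r)"
proof -
  obtain f where "\<And>x y. eval f [x, y] = Some (if (x, y) \<in> r then 1 else 0)"
    using assms(1) by (auto simp: computable_rel_def)
  then have "total_computable 2 (\<lambda>xs. of_bool ((xs ! 0, xs ! 1) \<in> r))"
    unfolding total_computable_def by (auto simp: numeral_2_eq_2 length_Suc_conv intro!: exI[of _ f])
  then show ?thesis
    using total_computable_compose[of "[F, G]" "\<lambda>xs. of_bool ((xs ! 0, xs ! 1) \<in> r)" n] assms(2,3)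
    by (auto simp: decidable_def numeral_2_eq_2)
qed


section \<open>Stagewise approximation of partial computable functions\<close>

text \<open>The approximation at stage \<open>s\<close> is \<open>0\<close> for \<open>undefined so far\<close> and \<open>Suc v\<close> for the
  value \<open>v\<close>. It need not be monotone in \<open>s\<close>, but it is never wrong.\<close>

definition approximates :: "nat \<Rightarrow> (nat list \<Rightarrow> nat) \<Rightarrow> recf \<Rightarrow> bool" where
  "approximates n T f \<longleftrightarrow> total_computable (Suc n) T \<and>
     (\<forall>xs. length xs = n \<longrightarrow>
        (\<forall>s v. T (s # xs) = Suc v \<longrightarrow> eval f xs = Some v) \<and>
        (\<forall>v. eval f xs = Some v \<longrightarrow> (\<forall>\<^sub>F s in sequentially. T (s # xs) = Suc v)))"

lemma approximatesI:
  assumes "total_computable (Suc n) T"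
    and "\<And>xs s v. length xs = n \<Longrightarrow> T (s # xs) = Suc v \<Longrightarrow> eval f xs = Some v"
    and "\<And>xs v. length xs = n \<Longrightarrow> eval f xs = Some v \<Longrightarrow> \<forall>\<^sub>F s in sequentially. T (s # xs) = Suc v"
  shows "approximates n T f"
  using assms by (simp add: approximates_def)

lemma approximatesD:
  assumes "approximates n T f"
  shows "total_computable (Suc n) T"
    and "length xs = n \<Longrightarrow> T (s # xs) = Suc v \<Longrightarrow> eval f xs = Some v"
    and "length xs = n \<Longrightarrow> eval f xs = Some v \<Longrightarrow> \<forall>\<^sub>F s in sequentially. T (s # xs) = Suc v"
  using assms by (simp_all add: approximates_def)

section \<open>Approximations for the individual Kleene schemes\<close>

lemma approximates_total:
  assumes "total_computable n F" "\<And>xs. length xs = n \<Longrightarrow> eval f xs = Some (F xs)"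
  shows "approximates n (\<lambda>xs. Suc (F (tl xs))) f"
  by (rule approximatesI) (use assms in \<open>auto intro: computable_intros\<close>)

lemma approximates_undefined:
  assumes "\<And>xs. length xs = n \<Longrightarrow> eval f xs = None"
  shows "approximates n (\<lambda>xs. 0) f"
  by (rule approximatesI) (use assms in \<open>auto intro: computable_intros\<close>)

text \<open>All inner terms and the outer term run at the same stage. As there are finitely many
  inner terms, from some stage on they all show their values, and subtracting 1 decodes the
  arguments of the outer term.\<close>

lemma approximates_Comp:
  assumes f: "approximates (length gs) T f" and g: "\<And>g. g \<in> set gs \<Longrightarrow> approximates n (U g) g"
  shows "approximates n (\<lambda>ys. if \<forall>g\<in>set gs. U g ys > 0
           then T (ys ! 0 # map (\<lambda>g. U g ys - 1) gs) else 0) (Comp f gs)"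
    (is "approximates n ?V _")
proof (rule approximatesI)
  let ?Gs = "(\<lambda>ys. ys ! 0) # map (\<lambda>g ys. U g ys - 1) gs"
  have "total_computable (Suc n) (\<lambda>ys. T (map (\<lambda>G. G ys) ?Gs))"
    by (rule total_computable_compose)
       (use approximatesD(1)[OF f] approximatesD(1)[OF g] in \<open>auto intro!: computable_intros\<close>)
  then have T: "total_computable (Suc n) (\<lambda>ys. T (ys ! 0 # map (\<lambda>g. U g ys - 1) gs))"
    by (simp add: comp_def)
  have dec: "decidable (Suc n) (\<lambda>ys. \<forall>g\<in>set gs. U g ys > 0)"
    using approximatesD(1)[OF g]
  proof (induction gs)
    case Nil
    have "decidable (Suc n) (\<lambda>_. 0 \<le> (0::nat))" by (intro computable_intros)
    then show ?case by simp
  qed (auto intro!: computable_intros)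
  \<comment> \<open>Multiplying by the truth value implements the case distinction; \<open>T\<close>
    is total, so its value on arguments decoded from \<open>0\<close> does no harm.\<close>
  have "total_computable (Suc n) (\<lambda>ys. of_bool (\<forall>g\<in>set gs. U g ys > 0) *
      T (ys ! 0 # map (\<lambda>g. U g ys - 1) gs))"
    by (intro computable_intros dec T)
  then show "total_computable (Suc n) ?V"
    by (rule total_computable_cong) simp
  fix xs :: "nat list" assume n: "length xs = n"
  show "eval (Comp f gs) xs = Some v" if V: "?V (s # xs) = Suc v" for s v
  proof -
    have pos: "\<forall>g\<in>set gs. U g (s # xs) > 0" using V by (simp split: if_splits)
    then have "eval g xs = Some (U g (s # xs) - 1)" if "g \<in> set gs" for g
      using approximatesD(2)[OF g[OF that] n, of s] that by simp
    then have "eval (Comp f gs) xs = eval f (map (\<lambda>g. U g (s # xs) - 1) gs)"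
      by (auto intro!: arg_cong[of _ _ "eval f"])
    also have "\<dots> = Some v"
      using approximatesD(2)[OF f] V pos by auto
    finally show ?thesis .
  qed
  show "\<forall>\<^sub>F s in sequentially. ?V (s # xs) = Suc v" if ev: "eval (Comp f gs) xs = Some v" for v
  proof -
    have def: "\<forall>g\<in>set gs. eval g xs \<noteq> None" and fv: "eval f (map (\<lambda>g. the (eval g xs)) gs) = Some v"
      using ev by (auto split: if_splits)
    have "\<forall>\<^sub>F s in sequentially. \<forall>g\<in>set gs. U g (s # xs) = Suc (the (eval g xs))"
      using def approximatesD(3)[OF g n] by (intro eventually_ball_finite) auto
    moreover have "\<forall>\<^sub>F s in sequentially. T (s # map (\<lambda>g. the (eval g xs)) gs) = Suc v"
      by (rule approximatesD(3)[OF f]) (use fv in auto)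
    ultimately show ?thesis
    proof eventually_elim
      case (elim s)
      have "map (\<lambda>g. U g (s # xs) - 1) gs = map (\<lambda>g. the (eval g xs)) gs"
        using elim(1) by auto
      moreover have "\<forall>g\<in>set gs. U g (s # xs) > 0" using elim(1) by simp
      ultimately show ?case using elim(2) by (simp only: nth_Cons_0) simp
    qed
  qed
qed

text \<open>One stage serves the base case and every step, and the code \<open>0\<close> for
  undefined is passed on through the recursion. Correctness and convergence follow by induction on
  the recursion argument.\<close>

lemma approximates_PrimRec:
  assumes f: "approximates n T f" and g: "approximates (Suc (Suc n)) U g"
  shows "approximates (Suc n) (\<lambda>ys. rec_nat (T (ys ! 0 # tl (tl ys)))
    (\<lambda>k r. if r = 0 then 0 else U (ys ! 0 # (r - 1) # k # tl (tl ys))) (ys ! 1)) (PrimRec f g)"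
    (is "approximates _ ?V _")
proof (rule approximatesI)
  have T: "total_computable (Suc (Suc n)) (\<lambda>ys. T (ys ! 0 # tl (tl ys)))"
  proof -
    let ?Gs = "(\<lambda>ys. ys ! 0) # map (\<lambda>i ys. ys ! Suc (Suc i)) [0..<n]"
    have "total_computable (Suc (Suc n)) (\<lambda>ys. T (map (\<lambda>G. G ys) ?Gs))"
      by (rule total_computable_compose)
         (use approximatesD(1)[OF f] in \<open>auto intro!: computable_intros\<close>)
    then show ?thesis
      by (rule total_computable_cong)
         (auto intro!: arg_cong[of _ _ T] nth_equalityI simp: nth_tl)
  qed
  \<comment> \<open>Ahead of the parameters stand four entries: previous value, counter, stage and
    recursion argument.\<close>
  have U: "total_computable (Suc (Suc (Suc (Suc n))))
      (\<lambda>zs. U (tl (tl zs) ! 0 # (zs ! 0 - 1) # zs ! 1 # tl (tl (tl (tl zs)))))"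
  proof -
    let ?Gs = "(\<lambda>zs. zs ! 2) # (\<lambda>zs. zs ! 0 - 1) # (\<lambda>zs. zs ! 1)
      # map (\<lambda>i zs. zs ! (i + 4)) [0..<n]"
    have "total_computable (Suc (Suc (Suc (Suc n)))) (\<lambda>zs. U (map (\<lambda>G. G zs) ?Gs))"
      by (rule total_computable_compose)
         (use approximatesD(1)[OF g] in \<open>auto intro!: computable_intros\<close>)
    then show ?thesis
      by (rule total_computable_cong)
         (auto intro!: arg_cong[of _ _ U] nth_equalityI simp: nth_tl numeral_eq_Suc length_Suc_conv)
  qed
  have "total_computable (Suc (Suc n)) (\<lambda>ys. rec_nat (T (ys ! 0 # tl (tl ys)))
      (\<lambda>k r. of_bool (0 < r) * U (ys ! 0 # (r - 1) # k # tl (tl ys))) (ys ! 1))"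
    by (intro computable_intros T U) simp_all
  moreover have "(\<lambda>k r. of_bool (0 < r) * U (s # (r - 1) # k # ws))
      = (\<lambda>k r. if r = 0 then 0 else U (s # (r - 1) # k # ws))" for s ws
    by (intro ext) simp
  ultimately show "total_computable (Suc (Suc n)) ?V" by simp
  fix xs :: "nat list" assume "length xs = Suc n"
  then obtain m ys where xs: "xs = m # ys" and n: "length ys = n"
    by (auto simp: length_Suc_conv)
  let ?E = "rec_nat (eval f ys) (\<lambda>k r. Option.bind r (\<lambda>y. eval g (y # k # ys)))"
  let ?R = "\<lambda>s. rec_nat (T (s # ys)) (\<lambda>k r. if r = 0 then 0 else U (s # (r - 1) # k # ys))"
  have "?R s m = Suc v \<Longrightarrow> ?E m = Some v" for s v m
  proof (induction m arbitrary: v)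
    case 0
    then show ?case using approximatesD(2)[OF f n] by simp
  next
    case (Suc m)
    then obtain w where w: "?R s m = Suc w" by (cases "?R s m") auto
    with Suc.prems have "U (s # w # m # ys) = Suc v" by simp
    then have "eval g (w # m # ys) = Some v"
      using approximatesD(2)[OF g] n by simp
    then show ?case using Suc.IH[OF w] by simp
  qed
  then show "eval (PrimRec f g) xs = Some v" if "?V (s # xs) = Suc v" for s v
    using that by (simp add: xs cong: if_cong)
  have "?E m = Some v \<Longrightarrow> \<forall>\<^sub>F s in sequentially. ?R s m = Suc v" for v m
  proof (induction m arbitrary: v)
    case 0
    then show ?case using approximatesD(3)[OF f n] by simp
  next
    case (Suc m)
    then obtain w where w: "?E m = Some w" and v: "eval g (w # m # ys) = Some v"
      by (cases "?E m") auto
    have "\<forall>\<^sub>F s in sequentially. U (s # w # m # ys) = Suc v"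
      using approximatesD(3)[OF g _ v] n by simp
    with Suc.IH[OF w] show ?case by eventually_elim simp
  qed
  then show "\<forall>\<^sub>F s in sequentially. ?V (s # xs) = Suc v" if "eval (PrimRec f g) xs = Some v" for v
    using that by (simp add: xs cong: if_cong)
qed

text \<open>At most one \<open>k\<close> satisfies the condition, so the sum is the bounded search for it.\<close>

lemma approximates_Mu:
  assumes f: "approximates (Suc n) T f"
  shows "approximates n (\<lambda>ys. \<Sum>k<ys ! 0. of_bool (T (ys ! 0 # k # tl ys) = 1 \<and>
    (\<forall>m<k. 1 < T (ys ! 0 # m # tl ys))) * Suc k) (Mu f)" (is "approximates _ ?V _")
proof (rule approximatesI)
  note T = total_computable_swap[OF approximatesD(1)[OF f]]
  have T': "total_computable (Suc (Suc (Suc n)))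
      (\<lambda>zs. T (tl (tl zs) ! 0 # zs ! 0 # tl (tl (tl zs))))"
  proof -
    let ?Gs = "(\<lambda>zs. zs ! 2) # (\<lambda>zs. zs ! 0) # map (\<lambda>i zs. zs ! (i + 3)) [0..<n]"
    have "total_computable (Suc (Suc (Suc n))) (\<lambda>zs. T (map (\<lambda>G. G zs) ?Gs))"
      by (rule total_computable_compose)
         (use approximatesD(1)[OF f] in \<open>auto intro!: computable_intros\<close>)
    then show ?thesis
      by (rule total_computable_cong)
         (auto intro!: arg_cong[of _ _ T] nth_equalityI simp: nth_tl numeral_eq_Suc length_Suc_conv)
  qed
  show "total_computable (Suc n) ?V"
    by (intro computable_intros T T') simp_all
  fix xs :: "nat list" assume n: "length xs = n"
  \<comment> \<open>The code \<open>1\<close> is the value 0, and any code above \<open>1\<close> is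
    a defined nonzero value; so \<open>?c s k\<close> says that stage \<open>s\<close> shows
    \<open>k\<close> as the first zero with all earlier values defined.\<close>
  let ?c = "\<lambda>s k. T (s # k # xs) = 1 \<and> (\<forall>m<k. 1 < T (s # m # xs))"
  have unique: "?V (s # xs) = (if k < s then Suc k else 0)" if c: "?c s k" for s k
  proof -
    have iff: "?c s i \<longleftrightarrow> i = k" for i
      by (metis c less_irrefl linorder_neqE_nat)
    have "?V (s # xs) = (\<Sum>i<s. of_bool (?c s i) * Suc i)" by simp
    also have "\<dots> = (\<Sum>i<s. if i = k then Suc i else 0)"
      unfolding iff by (intro sum.cong) auto
    finally show ?thesis by simp
  qed
  show "eval (Mu f) xs = Some v" if V: "?V (s # xs) = Suc v" for s v
  proof -
    have "\<exists>k. ?c s k"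
    proof (rule ccontr)
      assume no: "\<nexists>k. ?c s k"
      have "?V (s # xs) = (\<Sum>i<s. of_bool (?c s i) * Suc i)" by simp
      also have "\<dots> = 0" by (intro sum.neutral) (use no in auto)
      finally show False using V by (simp only:)
    qed
    then obtain k where k: "?c s k" by blast
    then have "v = k" using unique[OF k] V by (simp split: if_splits)
    have 0: "eval f (k # xs) = Some 0"
      using approximatesD(2)[OF f, of "k # xs" s 0] k n by simp
    have pos: "eval f (m # xs) = Some (Suc (T (s # m # xs) - 2))" if "m < k" for m
    proof -
      from k that have "T (s # m # xs) = Suc (Suc (T (s # m # xs) - 2))" by fastforce
      then show ?thesis using approximatesD(2)[OF f] n by (metis length_Cons)
    qed
    have least: "(LEAST n. eval f (n # xs) = Some 0) = k"
    proof (rule Least_equality)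
      show "k \<le> m" if "eval f (m # xs) = Some 0" for m
        using pos[of m] that by (cases "m < k") auto
    qed (rule 0)
    have "\<exists>n. eval f (n # xs) = Some 0 \<and> (\<forall>m<n. eval f (m # xs) \<noteq> None)"
      using 0 pos by (intro exI[of _ k]) simp
    then show ?thesis using \<open>v = k\<close> least by simp
  qed
  show "\<forall>\<^sub>F s in sequentially. ?V (s # xs) = Suc v" if ev: "eval (Mu f) xs = Some v" for v
  proof -
    obtain k where k: "eval f (k # xs) = Some 0" "\<forall>m<k. eval f (m # xs) \<noteq> None"
      and v: "v = (LEAST n. eval f (n # xs) = Some 0)"
      using ev by (auto split: if_splits)
    have v0: "eval f (v # xs) = Some 0" unfolding v by (rule LeastI, rule k)
    \<comment> \<open>The zero \<open>k\<close> that witnesses definedness need not be the least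
      one; as \<open>v \<le> k\<close>, all values below \<open>v\<close> are still defined, and
      they are nonzero by minimality.\<close>
    have "v \<le> k" unfolding v by (rule Least_le, rule k)
    have "\<exists>w. eval f (m # xs) = Some (Suc w)" if "m < v" for m
    proof (cases "eval f (m # xs)")
      case None
      then show ?thesis using k(2) that \<open>v \<le> k\<close> by simp
    next
      case (Some w)
      have "eval f (m # xs) \<noteq> Some 0" using not_less_Least that v by blast
      with Some show ?thesis by (cases w) auto
    qed
    then obtain w where w: "\<And>m. m < v \<Longrightarrow> eval f (m # xs) = Some (Suc (w m))" by metis
    have "\<forall>\<^sub>F s in sequentially. \<forall>m\<in>{..<v}. T (s # m # xs) = Suc (Suc (w m))"
      by (intro eventually_ball_finite) (use approximatesD(3)[OF f _ w] n in auto)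
    moreover have "\<forall>\<^sub>F s in sequentially. T (s # v # xs) = Suc 0"
      using approximatesD(3)[OF f _ v0] n by simp
    moreover have "\<forall>\<^sub>F s in sequentially. v < s" by (rule eventually_gt_at_top)
    ultimately show ?thesis
    proof eventually_elim
      case (elim s)
      then have "?c s v" by simp
      from unique[OF this] elim(3) show ?case by simp
    qed
  qed
qed

text \<open>Induction on the Kleene term, with the arity arbitrary because subterms are applied at
  other arities. A basic term or recursion at an unsuitable arity is undefined everywhere and is
  approximated by the constant 0.\<close>

lemma ex_approximates: "\<exists>T. approximates n T f"
proof (induction f arbitrary: n)
  case Zero
  have "approximates n (\<lambda>xs. Suc 0) Zero"
    by (rule approximates_total) (auto intro: computable_intros)
  then show ?case by blast
next
  case Succ
  show ?case
  proof (cases "n = 1")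
    case True
    have "approximates n (\<lambda>xs. Suc (Suc (tl xs ! 0))) Succ"
      by (rule approximates_total) (auto intro!: computable_intros simp: True length_Suc_conv)
    then show ?thesis by blast
  next
    case False
    have "approximates n (\<lambda>xs. 0) Succ"
      by (rule approximates_undefined) (use False in \<open>auto split: list.split\<close>)
    then show ?thesis by blast
  qed
next
  case (Proj i)
  show ?case
  proof (cases "i < n")
    case True
    have "approximates n (\<lambda>xs. Suc (tl xs ! i)) (Proj i)"
      by (rule approximates_total) (auto intro!: computable_intros simp: True)
    then show ?thesis by blast
  next
    case False
    have "approximates n (\<lambda>xs. 0) (Proj i)"
      by (rule approximates_undefined) (use False in auto)
    then show ?thesis by blast
  qed
next
  case (Comp f gs)
  obtain T where T: "approximates (length gs) T f" using Comp(1) by blast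
  have "\<forall>g\<in>set gs. \<exists>U. approximates n U g" using Comp(2) by blast
  then obtain U where "\<forall>g\<in>set gs. approximates n (U g) g" by (rule bchoice[THEN exE])
  then show ?case using approximates_Comp[OF T, of n U] by blast
next
  case (PrimRec f g)
  show ?case
  proof (cases n)
    case 0
    have "approximates n (\<lambda>xs. 0) (PrimRec f g)"
      by (rule approximates_undefined) (use 0 in auto)
    then show ?thesis by blast
  next
    case (Suc m)
    obtain T U where "approximates m T f" "approximates (Suc (Suc m)) U g"
      using PrimRec by blast
    then show ?thesis unfolding Suc using approximates_PrimRec by blast
  qed
next
  case (Mu f)
  then obtain T where "approximates (Suc n) T f" by blast
  then show ?case using approximates_Mu by blast
qed


section \<open>Semidecidable relations\<close>

text \<open>These are the c.e. relations. Asking \<open>R\<close> to hold at almost all stages,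
  rather than at one, lets several facts be read off at a common stage although \<open>R\<close>
  need not be monotone.\<close>

definition semidecidable :: "nat \<Rightarrow> (nat list \<Rightarrow> bool) \<Rightarrow> bool" where
  "semidecidable n Q \<longleftrightarrow> (\<exists>R. decidable (Suc n) R \<and> (\<forall>xs. length xs = n \<longrightarrow>
     (\<forall>s. R (s # xs) \<longrightarrow> Q xs) \<and> (Q xs \<longrightarrow> (\<forall>\<^sub>F s in sequentially. R (s # xs)))))"

lemma semidecidableI:
  assumes "decidable (Suc n) R"
    and "\<And>s xs. length xs = n \<Longrightarrow> R (s # xs) \<Longrightarrow> Q xs"
    and "\<And>xs. length xs = n \<Longrightarrow> Q xs \<Longrightarrow> \<forall>\<^sub>F s in sequentially. R (s # xs)"
  shows "semidecidable n Q"
  using assms unfolding semidecidable_def by blast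

lemma semidecidableE:
  assumes "semidecidable n Q"
  obtains R where "decidable (Suc n) R"
    and "\<And>s xs. length xs = n \<Longrightarrow> R (s # xs) \<Longrightarrow> Q xs"
    and "\<And>xs. length xs = n \<Longrightarrow> Q xs \<Longrightarrow> \<forall>\<^sub>F s in sequentially. R (s # xs)"
  using assms unfolding semidecidable_def by blast

named_theorems semidecidable_intros

lemma semidecidable_decidable:
  assumes "decidable n P"
  shows "semidecidable n P"
  by (rule semidecidableI[OF decidable_tl[OF assms]]) auto

lemma semidecidable_conj [semidecidable_intros]:
  assumes "semidecidable n P" "semidecidable n Q"
  shows "semidecidable n (\<lambda>xs. P xs \<and> Q xs)"
proof -
  obtain R where R: "decidable (Suc n) R"
    "\<And>s xs. length xs = n \<Longrightarrow> R (s # xs) \<Longrightarrow> P xs"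
    "\<And>xs. length xs = n \<Longrightarrow> P xs \<Longrightarrow> \<forall>\<^sub>F s in sequentially. R (s # xs)"
    using assms(1) by (rule semidecidableE) (rule that, assumption, blast, blast)
  obtain S where S: "decidable (Suc n) S"
    "\<And>s xs. length xs = n \<Longrightarrow> S (s # xs) \<Longrightarrow> Q xs"
    "\<And>xs. length xs = n \<Longrightarrow> Q xs \<Longrightarrow> \<forall>\<^sub>F s in sequentially. S (s # xs)"
    using assms(2) by (rule semidecidableE) (rule that, assumption, blast, blast)
  show ?thesis
    by (rule semidecidableI[OF decidable_conj[OF R(1) S(1)]])
       (use R(2,3) S(2,3) in \<open>auto intro: eventually_conj\<close>)
qed

text \<open>Stage \<open>s\<close> tries only the witnesses below \<open>s\<close>; any fixed
  witness is eventually among them and eventually confirmed.\<close>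

lemma semidecidable_ex [semidecidable_intros]:
  assumes "semidecidable (Suc n) (\<lambda>ys. Q (ys ! 0) (tl ys))"
  shows "semidecidable n (\<lambda>xs. \<exists>a. Q a xs)"
proof -
  obtain R where R: "decidable (Suc (Suc n)) R"
    "\<And>s ys. length ys = Suc n \<Longrightarrow> R (s # ys) \<Longrightarrow> Q (ys ! 0) (tl ys)"
    "\<And>ys. length ys = Suc n \<Longrightarrow> Q (ys ! 0) (tl ys) \<Longrightarrow> \<forall>\<^sub>F s in sequentially. R (s # ys)"
    using assms by (rule semidecidableE) (rule that, assumption, blast, blast)
  show ?thesis
  proof (rule semidecidableI)
    have "decidable (Suc (Suc n)) (\<lambda>zs. R (tl zs ! 0 # zs ! 0 # tl (tl zs)))"
      using total_computable_swap R(1) unfolding decidable_def by blast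
    then show "decidable (Suc n) (\<lambda>ys. \<exists>a<ys ! 0. R (ys ! 0 # a # tl ys))"
      by (intro computable_intros) simp_all
    fix xs :: "nat list" assume n: "length xs = n"
    show "\<exists>a. Q a xs" if "\<exists>a<(s # xs) ! 0. R ((s # xs) ! 0 # a # tl (s # xs))" for s
      using that R(2)[of "_ # xs"] n by fastforce
    assume "\<exists>a. Q a xs"
    then obtain a where "Q a xs" by blast
    then have "\<forall>\<^sub>F s in sequentially. R (s # a # xs)"
      using R(3)[of "a # xs"] n by simp
    with eventually_gt_at_top[of a]
    show "\<forall>\<^sub>F s in sequentially. \<exists>a<(s # xs) ! 0. R ((s # xs) ! 0 # a # tl (s # xs))"
      by eventually_elim auto
  qed
qed

text \<open>The approximation of a Kleene term for \<open>\<phi>\<close> settles on the successor of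
  the value and shows no wrong successor before.\<close>

lemma semidecidable_graph [semidecidable_intros]:
  assumes "partial_computable \<phi>" "total_computable n F" "total_computable n G"
  shows "semidecidable n (\<lambda>xs. \<phi> (F xs) = Some (G xs))"
proof -
  obtain f where f: "\<And>x. \<phi> x = eval f [x]"
    using assms(1) by (auto simp: partial_computable_def)
  obtain T where T: "approximates 1 T f" using ex_approximates by blast
  have "total_computable (Suc n) (\<lambda>ys. T (map (\<lambda>G. G ys) [\<lambda>ys. ys ! 0, \<lambda>ys. F (tl ys)]))"
    by (rule total_computable_compose)
       (use approximatesD(1)[OF T] assms(2) in \<open>auto intro: computable_intros simp: numeral_2_eq_2\<close>)
  then have "decidable (Suc n) (\<lambda>ys. T [ys ! 0, F (tl ys)] = Suc (G (tl ys)))"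
    by (intro computable_intros assms(3)) simp
  then show ?thesis
    by (rule semidecidableI) (use approximatesD(2,3)[OF T] f in auto)
qed

section \<open>Selecting values from c.e. relations\<close>

lemma card_less_Least:
  fixes t :: nat
  assumes "a < t" "P a"
  shows "card {a. a < t \<and> (\<forall>b<Suc a. \<not> P b)} = (LEAST a. P a)"
proof -
  define m where "m = (LEAST a. P a)"
  have m: "m \<le> a" "P m" "\<And>b. b < m \<Longrightarrow> \<not> P b"
    using assms(2) unfolding m_def by (auto intro: Least_le LeastI dest: not_less_Least)
  \<comment> \<open>The least witness is written as a count because bounded counting is already
    known to be computable: the counted numbers are those with no witness up to and including
    themselves.\<close>
  have "i < t \<and> (\<forall>b<Suc i. \<not> P b) \<longleftrightarrow> i < m" for i
  proof
    assume "i < t \<and> (\<forall>b<Suc i. \<not> P b)"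
    then have "\<not> m < Suc i" using m(2) by blast
    then show "i < m" by simp
  next
    assume i: "i < m"
    then have "\<not> P b" if "b < Suc i" for b using m(3) that by simp
    moreover have "i < t" using i m(1) assms(1) by simp
    ultimately show "i < t \<and> (\<forall>b<Suc i. \<not> P b)" by blast
  qed
  then show ?thesis by (simp add: m_def)
qed

text \<open>Uniformisation of a c.e. relation. The search is for the first stage confirming some
  value below it, and the least value confirmed at that stage is taken; a search over values first
  could wait forever on a value that is never confirmed.\<close>

lemma semidecidable_selection:
  assumes "semidecidable 2 Q"
  shows "\<exists>\<theta>. partial_computable \<theta> \<and> (\<forall>x a. \<theta> x = Some a \<longrightarrow> Q [x, a]) \<and> dom \<theta> = {x. \<exists>a. Q [x, a]}"
proof -
  obtain R where R: "decidable (Suc 2) R"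
    "\<And>s ys. length ys = 2 \<Longrightarrow> R (s # ys) \<Longrightarrow> Q ys"
    "\<And>ys. length ys = 2 \<Longrightarrow> Q ys \<Longrightarrow> \<forall>\<^sub>F s in sequentially. R (s # ys)"
    using assms by (rule semidecidableE) (rule that, assumption, blast, blast)
  have dec: "decidable n (\<lambda>xs. R [A xs, B xs, D xs])"
    if "total_computable n A" "total_computable n B" "total_computable n D" for n A B D
    using decidable_compose[of "[A, B, D]" R n] R(1) that by (auto simp: numeral_2_eq_2)
  define D where "D t x \<longleftrightarrow> (\<exists>a<t. R [t, x, a])" for t x
  \<comment> \<open>\<open>Mu\<close> looks for zeros, so the test is negated: \<open>m\<close>
    vanishes exactly at the stages where \<open>D\<close> holds.\<close>
  have "total_computable 2 (\<lambda>xs. of_bool (\<not> (\<exists>a<xs ! 0. R [xs ! 0, xs ! 1, a])))"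
    by (intro computable_intros) (auto intro!: dec computable_intros simp: numeral_2_eq_2)
  then obtain m where m: "\<And>xs. length xs = 2 \<Longrightarrow> eval m xs = Some (of_bool (\<not> D (xs ! 0) (xs ! 1)))"
    by (auto simp: total_computable_def D_def)
  have "total_computable 2 (\<lambda>xs. card {a. a < xs ! 0 \<and> (\<forall>b<Suc a. \<not> R [xs ! 0, xs ! 1, b])})"
    by (intro computable_intros) (auto intro!: dec computable_intros simp: numeral_2_eq_2)
  then obtain g where g: "\<And>xs. length xs = 2 \<Longrightarrow>
      eval g xs = Some (card {a. a < xs ! 0 \<and> (\<forall>b<Suc a. \<not> R [xs ! 0, xs ! 1, b])})"
    by (auto simp: total_computable_def)
  \<comment> \<open>\<open>Mu m\<close> finds the stage, and \<open>g\<close> reads off the value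
    confirmed there for the same \<open>x\<close>.\<close>
  define \<theta> where "\<theta> x = eval (Comp g [Mu m, Proj 0]) [x]" for x
  have some: "\<exists>a. \<theta> x = Some a \<and> Q [x, a]" if "D t x" for t x
  proof -
    define u where "u = (LEAST t. D t x)"
    have u: "D u x" unfolding u_def using that by (rule LeastI)
    then obtain a where a: "a < u" "R [u, x, a]" by (auto simp: D_def)
    have "eval (Mu m) [x] = Some u" using u m by (auto simp: u_def)
    then have "\<theta> x = Some (card {a. a < u \<and> (\<forall>b<Suc a. \<not> R [u, x, b])})"
      using g by (simp add: \<theta>_def)
    also have "card {a. a < u \<and> (\<forall>b<Suc a. \<not> R [u, x, b])} = (LEAST a. R [u, x, a])"
      using a by (rule card_less_Least)
    finally show ?thesis
      using R(2)[of "[x, LEAST a. R [u, x, a]]" u] LeastI[of "\<lambda>a. R [u, x, a]", OF a(2)] by simp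
  qed
  have none: "\<theta> x = None" if "\<And>t. \<not> D t x" for x
    using that m by (simp add: \<theta>_def)
  have ex: "\<exists>t. D t x" if "Q [x, a]" for x a
  proof -
    have "\<forall>\<^sub>F s in sequentially. a < s \<and> R [s, x, a]"
      using R(3)[of "[x, a]"] that eventually_gt_at_top[of a] by (auto intro: eventually_conj)
    then show ?thesis
      unfolding D_def eventually_sequentially by blast
  qed
  have "partial_computable \<theta>" unfolding partial_computable_def \<theta>_def by blast
  moreover have sound: "Q [x, a]" if "\<theta> x = Some a" for x a
    using some none that by (metis option.inject option.distinct(1))
  moreover have "x \<in> dom \<theta> \<longleftrightarrow> (\<exists>a. Q [x, a])" for x
  proof
    assume "\<exists>a. Q [x, a]"
    then obtain t where "D t x" using ex by blast
    then show "x \<in> dom \<theta>" using some by blast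
  qed (use sound in blast)
  ultimately show ?thesis by blast
qed

lemma ce_set_semidecidable:
  "semidecidable 2 Q \<Longrightarrow> ce_set {x. \<exists>a. Q [x, a]}"
  using semidecidable_selection[of Q] unfolding ce_set_def by metis


section \<open>A saturation property of cohesive powers\<close>

lemma almost_subset_mono: "C \<subseteq>* A \<Longrightarrow> A \<subseteq> B \<Longrightarrow> C \<subseteq>* B"
  unfolding almost_subset_def by (rule finite_subset[rotated]) auto

lemma almost_subset_INT:
  assumes "finite I" "\<And>i. i \<in> I \<Longrightarrow> C \<subseteq>* A i"
  shows "C \<subseteq>* (\<Inter>i\<in>I. A i)"
proof -
  have "C - (\<Inter>i\<in>I. A i) = (\<Union>i\<in>I. C - A i)" by blast
  then show ?thesis using assms by (metis almost_subset_def finite_UN_I)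
qed

lemma cohesive_ce_cases:
  assumes "cohesive C" "ce_set W" "infinite (C \<inter> W)"
  shows "C \<subseteq>* W"
  using assms by (auto simp: cohesive_def almost_subset_def)

text \<open>A saturation principle for a decreasing c.e. family of conditions: each level alone can
  be met almost everywhere on \<open>C\<close>, and stagewise guessing merges the levels into one
  function that meets all of them.\<close>

lemma cohesive_saturation:
  fixes Q :: "nat \<Rightarrow> nat \<Rightarrow> nat \<Rightarrow> bool"
  assumes C: "co_ce C" "cohesive C"
    and Q: "semidecidable 3 (\<lambda>xs. Q (xs ! 0) (xs ! 1) (xs ! 2))"
    and anti: "\<And>x k a. Q x (Suc k) a \<Longrightarrow> Q x k a"
    and full: "\<And>k. C \<subseteq>* {x. \<exists>a. Q x k a}"
  shows "\<exists>\<theta>. partial_computable \<theta> \<and> (\<forall>x a. \<theta> x = Some a \<longrightarrow> Q x 0 a) \<and>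
    (\<forall>k. C \<subseteq>* {x. \<exists>a. \<theta> x = Some a \<and> Q x k a})"
proof -
  have antimono: "Q x k a" if "Q x k' a" "k \<le> k'" for x k k' a
    using that(2,1) by (induction rule: dec_induct) (auto dest: anti)
  obtain R where R: "decidable (Suc 3) R"
    "\<And>s x k a. R [s, x, k, a] \<Longrightarrow> Q x k a"
    "\<And>x k a. Q x k a \<Longrightarrow> \<forall>\<^sub>F s in sequentially. R [s, x, k, a]"
  proof -
    obtain R where R: "decidable (Suc 3) R"
      "\<And>s xs. length xs = 3 \<Longrightarrow> R (s # xs) \<Longrightarrow> Q (xs ! 0) (xs ! 1) (xs ! 2)"
      "\<And>xs. length xs = 3 \<Longrightarrow> Q (xs ! 0) (xs ! 1) (xs ! 2) \<Longrightarrow> \<forall>\<^sub>F s in sequentially. R (s # xs)"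
      using Q by (rule semidecidableE) (rule that, assumption, blast, blast)
    show thesis
      by (rule that[OF R(1)]) (use R(2,3)[of "[_, _, _]"] in auto)
  qed
  obtain \<chi> where \<chi>: "partial_computable \<chi>" "- C = dom \<chi>"
    using C(1) by (auto simp: co_ce_def ce_set_def)
  have "semidecidable 1 (\<lambda>xs. \<exists>b. \<chi> (xs ! 0) = Some b)"
    by (intro semidecidable_intros \<chi>) (auto intro!: computable_intros simp: numeral_2_eq_2)
  then obtain V where V: "decidable (Suc 1) V"
    "\<And>s x. V [s, x] \<Longrightarrow> x \<notin> C"
    "\<And>x. x \<notin> C \<Longrightarrow> \<forall>\<^sub>F s in sequentially. V [s, x]"
  proof (rule semidecidableE)
    fix V assume V: "decidable (Suc 1) V"
      "\<And>s xs. length xs = 1 \<Longrightarrow> V (s # xs) \<Longrightarrow> \<exists>b. \<chi> (xs ! 0) = Some b"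
      "\<And>xs. length xs = 1 \<Longrightarrow> \<exists>b. \<chi> (xs ! 0) = Some b \<Longrightarrow> \<forall>\<^sub>F s in sequentially. V (s # xs)"
    have "x \<notin> C \<longleftrightarrow> (\<exists>b. \<chi> x = Some b)" for x using \<chi>(2) by (auto simp: dom_def)
    then show thesis
      by (intro that[OF V(1)]) (use V(2,3)[of "[_]"] in auto)
  qed
  have decR: "decidable n (\<lambda>xs. R [F xs, G xs, H xs, K xs])"
    if "total_computable n F" "total_computable n G" "total_computable n H" "total_computable n K"
    for n F G H K
    using decidable_compose[of "[F, G, H, K]" R n] R(1) that by (auto simp: numeral_3_eq_3)
  have decV: "decidable n (\<lambda>xs. V [F xs, G xs])"
    if "total_computable n F" "total_computable n G" for n F G
    using decidable_compose[of "[F, G]" V n] V(1) that by auto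
  \<comment> \<open>\<open>k \<le> x\<close> drives the guesses out to infinity, \<open>V\<close>
    discards numbers seen to lie outside \<open>C\<close>, and the bounded search asks for a witness
    confirmed so far.\<close>
  define A where "A x k s \<longleftrightarrow> k \<le> x \<and> \<not> V [s, x] \<and> (\<exists>a<s. R [s, x, k, a])" for x k s
  define pick where "pick x k s \<longleftrightarrow> A x k s \<and> (\<forall>y<x. \<not> A y k s)" for x k s
  \<comment> \<open>\<open>pick x k s\<close>: at stage \<open>s\<close>, \<open>x\<close> is the guess for the least \<open>m \<ge> k\<close> in \<open>C\<close> at which \<open>Q\<close> holds
    at level \<open>k\<close>.\<close>
  have pick_unique: "x = y" if "pick x k s" "pick y k s" for x y k s
    using that by (metis pick_def linorder_neqE_nat)
  have pick_stable: "\<exists>m\<in>C. k \<le> m \<and> (\<exists>a. Q m k a) \<and> (\<forall>\<^sub>F s in sequentially. pick m k s)" for k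
  proof -
    let ?P = "\<lambda>x. x \<in> C \<and> k \<le> x \<and> (\<exists>a. Q x k a)"
    have "infinite (C - (C - {x. \<exists>a. Q x k a}))"
      using full[of k] C(2) by (simp add: almost_subset_def cohesive_def Diff_infinite_finite)
    then obtain x where "k \<le> x" "x \<in> C - (C - {x. \<exists>a. Q x k a})"
      unfolding finite_nat_set_iff_bounded_le by (meson nat_le_linear)
    then have x: "?P x" by blast
    define m where "m = (LEAST x. ?P x)"
    have m: "?P m" unfolding m_def using x by (rule LeastI)
    have less: "\<not> ?P y" if "y < m" for y using that not_less_Least unfolding m_def by blast
    from m obtain a where a: "Q m k a" by blast
    have "\<forall>\<^sub>F s in sequentially. A m k s"
      using R(3)[OF a] eventually_gt_at_top[of a]
    proof eventually_elim
      case (elim s)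
      moreover have "\<not> V [s, m]" using m V(2) by blast
      ultimately show ?case using m unfolding A_def by blast
    qed
    \<comment> \<open>A competitor below \<open>m\<close> is excluded for one of two reasons: inside
      \<open>C\<close> it fails the conditions by minimality of \<open>m\<close>, and false
      witnesses are never confirmed; outside \<open>C\<close> it is eventually discarded by
      \<open>V\<close>.\<close>
    moreover have "\<forall>\<^sub>F s in sequentially. \<not> A y k s" if "y < m" for y
    proof (cases "y \<in> C")
      case True
      then have "\<not> A y k s" for s using less[OF that] R(2) unfolding A_def by blast
      then show ?thesis by simp
    next
      case False
      from V(3)[OF this] show ?thesis by eventually_elim (simp add: A_def)
    qed
    then have "\<forall>\<^sub>F s in sequentially. \<forall>y\<in>{..<m}. \<not> A y k s"
      by (intro eventually_ball_finite) auto
    ultimately have "\<forall>\<^sub>F s in sequentially. pick m k s"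
      by eventually_elim (simp add: pick_def)
    with m show ?thesis by blast
  qed
  have pick_finite: "finite {x. \<exists>s. pick x k s}" for k
  proof -
    obtain m N where "\<And>s. s \<ge> N \<Longrightarrow> pick m k s"
      using pick_stable[of k] unfolding eventually_sequentially by blast
    \<comment> \<open>From stage \<open>N\<close> on only \<open>m\<close> is guessed, and each
      earlier stage contributes at most one number.\<close>
    then have "{x. \<exists>s. pick x k s} \<subseteq> insert m (\<Union>s<N. {x. pick x k s})"
      using pick_unique by (smt (verit, best) UN_I insertCI lessThan_iff mem_Collect_eq not_le_imp_less subsetI)
    moreover have "finite {x. pick x k s}" for s
    proof (cases "\<exists>y. pick y k s")
      case True
      then obtain y where "pick y k s" by blast
      then have "{x. pick x k s} \<subseteq> {y}" using pick_unique by blast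
      then show ?thesis by (rule finite_subset) simp
    qed simp
    ultimately show ?thesis by (simp add: finite_subset)
  qed
  \<comment> \<open>The value at \<open>x\<close> may come from any level \<open>k\<close> at which
    \<open>x\<close> was ever guessed, with a witness for that level.\<close>
  let ?Q = "\<lambda>xs. \<exists>k s. pick (xs ! 0) k s \<and> Q (xs ! 0) k (xs ! 1)"
  have decA: "decidable n (\<lambda>xs. A (F xs) (G xs) (H xs))"
    if "total_computable n F" "total_computable n G" "total_computable n H" for n F G H
    unfolding A_def
    by (intro decidable_conj decidable_not decidable_ex_less decidable_le decV decR
          total_computable_tl total_computable_nth that) simp
  have decPick: "decidable n (\<lambda>xs. pick (F xs) (G xs) (H xs))"
    if "total_computable n F" "total_computable n G" "total_computable n H" for n F G H
    unfolding pick_def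
    by (intro decidable_conj decidable_not decidable_all_less decA
          total_computable_tl total_computable_nth that) simp
  have semiQ: "semidecidable n (\<lambda>xs. Q (F xs) (G xs) (H xs))"
    if "total_computable n F" "total_computable n G" "total_computable n H" for n F G H
  proof (rule semidecidableI)
    show "decidable (Suc n) (\<lambda>ys. R [ys ! 0, F (tl ys), G (tl ys), H (tl ys)])"
      by (intro decR total_computable_tl total_computable_nth that) simp
  qed (use R(2,3) in auto)
  have "semidecidable 2 ?Q"
    by (intro semidecidable_intros semidecidable_decidable[OF decPick] semiQ)
       (auto intro!: computable_intros simp: numeral_2_eq_2)
  from semidecidable_selection[OF this] obtain \<theta> where \<theta>: "partial_computable \<theta>"
    "\<And>x a. \<theta> x = Some a \<Longrightarrow> \<exists>k s. pick x k s \<and> Q x k a"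
    "dom \<theta> = {x. \<exists>a k s. pick x k s \<and> Q x k a}"
    by auto
  \<comment> \<open>The limit guesses lie in \<open>C\<close> and in the domain, and are unbounded
    since the one for \<open>k\<close> is at least \<open>k\<close>; cohesiveness then puts almost
    all of \<open>C\<close> into the domain.\<close>
  have "\<exists>m\<in>C \<inter> dom \<theta>. k \<le> m" for k
    using pick_stable[of k] unfolding \<theta>(3) eventually_sequentially by blast
  then have "infinite (C \<inter> dom \<theta>)"
    unfolding finite_nat_set_iff_bounded_le by (meson Suc_n_not_le_n order_trans)
  then have dom: "C \<subseteq>* dom \<theta>"
    using cohesive_ce_cases[OF C(2)] \<theta>(1) by (auto simp: ce_set_def)
  have "C \<subseteq>* {x. \<exists>a. \<theta> x = Some a \<and> Q x k a}" for k
  proof -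
    \<comment> \<open>A value chosen at a level \<open>k' \<ge> k\<close> also meets level
      \<open>k\<close>. Failures come only from outside the domain or from the finitely many numbers
      guessed for lower levels.\<close>
    have "C - {x. \<exists>a. \<theta> x = Some a \<and> Q x k a} \<subseteq>
        (C - dom \<theta>) \<union> (\<Union>k'<k. {x. \<exists>s. pick x k' s})"
    proof (rule subsetI)
      fix x assume x: "x \<in> C - {x. \<exists>a. \<theta> x = Some a \<and> Q x k a}"
      show "x \<in> (C - dom \<theta>) \<union> (\<Union>k'<k. {x. \<exists>s. pick x k' s})"
      proof (cases "\<theta> x")
        case None
        then show ?thesis using x by auto
      next
        case (Some a)
        then obtain k' s where ks: "pick x k' s" "Q x k' a" using \<theta>(2) by blast
        have "\<not> Q x k a" using x Some by simp
        then have "k' < k" using antimono[OF ks(2), of k] by (cases "k' < k") simp_all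
        then show ?thesis using ks(1) by blast
      qed
    qed
    moreover have "finite ((C - dom \<theta>) \<union> (\<Union>k'<k. {x. \<exists>s. pick x k' s}))"
      using dom pick_finite by (simp add: almost_subset_def)
    ultimately show ?thesis unfolding almost_subset_def by (rule finite_subset)
  qed
  moreover have "Q x 0 a" if "\<theta> x = Some a" for x a
    using \<theta>(2)[OF that] antimono[OF _ le0] by blast
  ultimately show ?thesis using \<theta>(1) by blast
qed


section \<open>Intervals with many elements\<close>

text \<open>Cutting the interval off at \<open>t\<close> makes the count decidable and leaves a
  single existential quantifier; it also keeps \<open>card\<close> meaningful when the interval is
  infinite.\<close>

definition many_between :: "nat rel \<Rightarrow> nat \<Rightarrow> nat \<Rightarrow> nat \<Rightarrow> bool" where
  "many_between r k a b \<longleftrightarrow> (\<exists>t. k \<le> card {c. c < t \<and> (a, c) \<in> r \<and> (c, b) \<in> r})"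

lemma many_betweenI:
  assumes "finite F" "k \<le> card F" "\<And>c. c \<in> F \<Longrightarrow> (a, c) \<in> r \<and> (c, b) \<in> r"
  shows "many_between r k a b"
proof -
  obtain t where "\<forall>c\<in>F. c < t" using assms(1) finite_nat_set_iff_bounded by blast
  then have "F \<subseteq> {c. c < t \<and> (a, c) \<in> r \<and> (c, b) \<in> r}" using assms(3) by blast
  then have "card F \<le> card {c. c < t \<and> (a, c) \<in> r \<and> (c, b) \<in> r}"
    by (rule card_mono[rotated]) simp
  then show ?thesis unfolding many_between_def using assms(2) le_trans by blast
qed

lemma many_between_mono: "many_between r k a b \<Longrightarrow> j \<le> k \<Longrightarrow> many_between r j a b"
  unfolding many_between_def using le_trans by blast

lemma many_between_less:
  assumes "trans r" "many_between r (Suc k) a b"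
  shows "(a, b) \<in> r"
proof -
  obtain t where "Suc k \<le> card {c. c < t \<and> (a, c) \<in> r \<and> (c, b) \<in> r}"
    using assms(2) by (auto simp: many_between_def)
  then have "{c. c < t \<and> (a, c) \<in> r \<and> (c, b) \<in> r} \<noteq> {}" by (metis card.empty Suc_n_not_le_n le0 le_trans not_less_eq_eq)
  then show ?thesis using assms(1) by (auto dest: transD)
qed

lemma semidecidable_many_between:
  assumes "computable_rel r"
    "total_computable n K" "total_computable n F" "total_computable n G"
  shows "semidecidable n (\<lambda>xs. many_between r (K xs) (F xs) (G xs))"
  unfolding many_between_def
  by (intro semidecidable_ex semidecidable_decidable decidable_le total_computable_card
        decidable_conj computable_rel_decidable total_computable_tl total_computable_nth assms)
     simp_all

text \<open>The rank is strictly increasing, hence injective, and lies below \<open>card F\<close>;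
  an injection between finite sets of equal size is onto.\<close>

lemma rank_surj:
  assumes "strict_linear_order_on L r" "finite F" "F \<subseteq> L" "k < card F"
  shows "\<exists>a\<in>F. card {c\<in>F. (c, a) \<in> r} = k"
proof -
  let ?f = "\<lambda>a. card {c\<in>F. (c, a) \<in> r}"
  have r: "trans r" "irrefl r" "total_on L r"
    using assms(1) by (auto simp: strict_linear_order_on_def)
  have less: "?f a < ?f b" if "(a, b) \<in> r" "a \<in> F" for a b
  proof (rule psubset_card_mono)
    have "{c\<in>F. (c, a) \<in> r} \<subseteq> {c\<in>F. (c, b) \<in> r}"
      using that r(1) by (auto dest: transD)
    moreover have "a \<in> {c\<in>F. (c, b) \<in> r}" "a \<notin> {c\<in>F. (c, a) \<in> r}"
      using that r(2) by (auto simp: irrefl_def)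
    ultimately show "{c\<in>F. (c, a) \<in> r} \<subset> {c\<in>F. (c, b) \<in> r}" by blast
  qed (use assms(2) in simp)
  have "inj_on ?f F"
  proof (rule inj_onI, rule ccontr)
    fix a b assume ab: "a \<in> F" "b \<in> F" "?f a = ?f b" "a \<noteq> b"
    then have "(a, b) \<in> r \<or> (b, a) \<in> r" using r(3) assms(3) by (auto simp: total_on_def)
    then show False using less ab by fastforce
  qed
  then have "card (?f ` F) = card {..<card F}" by (simp add: card_image)
  moreover have "?f ` F \<subseteq> {..<card F}"
  proof (rule image_subsetI)
    fix a assume "a \<in> F"
    then have "{c\<in>F. (c, a) \<in> r} \<subset> F" using r(2) by (auto simp: irrefl_def)
    then show "?f a \<in> {..<card F}" using assms(2) by (simp add: psubset_card_mono)
  qed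
  ultimately have "?f ` F = {..<card F}" by (intro card_subset_eq) auto
  then have "k \<in> ?f ` F" using assms(4) by simp
  then show ?thesis by blast
qed

text \<open>The witness has rank \<open>k\<close> among at least \<open>2 * k + 1\<close>
  intermediate elements: \<open>k\<close> of them lie below it, and removing these and itself leaves
  at least \<open>k\<close> above.\<close>

lemma many_between_middle:
  assumes "strict_linear_order_on L r" "r \<subseteq> L \<times> L" "many_between r (2 * k + 1) u v"
  shows "\<exists>a. (u, a) \<in> r \<and> (a, v) \<in> r \<and> many_between r k u a \<and> many_between r k a v"
proof -
  obtain t where t: "2 * k + 1 \<le> card {c. c < t \<and> (u, c) \<in> r \<and> (c, v) \<in> r}"
    using assms(3) by (auto simp: many_between_def)
  define F where "F = {c. c < t \<and> (u, c) \<in> r \<and> (c, v) \<in> r}"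
  have F: "finite F" "F \<subseteq> L" "k < card F"
    using t assms(2) by (auto simp: F_def)
  obtain a where a: "a \<in> F" "card {c\<in>F. (c, a) \<in> r} = k"
    using rank_surj[OF assms(1) F] by blast
  have "F \<subseteq> insert a ({c\<in>F. (c, a) \<in> r} \<union> {c\<in>F. (a, c) \<in> r})"
    using a(1) F(2) assms(1) by (auto simp: strict_linear_order_on_def total_on_def)
  then have "card F \<le> card (insert a ({c\<in>F. (c, a) \<in> r} \<union> {c\<in>F. (a, c) \<in> r}))"
    by (rule card_mono[rotated]) (use F(1) in simp)
  also have "\<dots> \<le> Suc (card ({c\<in>F. (c, a) \<in> r} \<union> {c\<in>F. (a, c) \<in> r}))"
    using F(1) by (simp add: card_insert_if)
  also have "\<dots> \<le> Suc (k + card {c\<in>F. (a, c) \<in> r})"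
    using card_Un_le[of "{c\<in>F. (c, a) \<in> r}"] a(2) by simp
  finally have "k \<le> card {c\<in>F. (a, c) \<in> r}" using t unfolding F_def[symmetric] by simp
  then have "many_between r k a v"
    by (rule many_betweenI[rotated]) (use F(1) in \<open>auto simp: F_def\<close>)
  moreover have "many_between r k u a"
    by (rule many_betweenI[of "{c\<in>F. (c, a) \<in> r}"]) (use F(1) a(2) in \<open>auto simp: F_def\<close>)
  ultimately show ?thesis using a(1) by (auto simp: F_def)
qed


section \<open>Blocks in linear orders\<close>

text \<open>Were some \<open>x\<close> of the first block not below some \<open>y\<close> of the
  second, \<open>y\<close> would be at most \<open>x\<close>, and the interval from \<open>p\<close>
  to \<open>q\<close> would be covered by the finite intervals between \<open>p\<close> and
  \<open>x\<close> and between \<open>q\<close> and \<open>y\<close>.\<close>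

lemma block_less_block:
  assumes lin: "trans r" "total_on M r" and M: "p \<in> M" "q \<in> M"
    and inf: "infinite {z \<in> M. (p, z) \<in> r\<^sup>= \<and> (z, q) \<in> r\<^sup>=}"
  shows "block_less r (block M r p) (block M r q)"
  unfolding block_less_def
proof (intro ballI, rule ccontr)
  fix x y assume x: "x \<in> block M r p" and y: "y \<in> block M r q" and nless: "(x, y) \<notin> r"
  have xy: "x \<in> M" "y \<in> M" and fin: "finite (closed_between M r p x)" "finite (closed_between M r q y)"
    using x y by (auto simp: block_def)
  have le: "(y, x) \<in> r\<^sup>=" using nless xy lin(2) by (auto simp: total_on_def)
  have tr: "(a, b) \<in> r\<^sup>= \<Longrightarrow> (b, c) \<in> r\<^sup>= \<Longrightarrow> (a, c) \<in> r\<^sup>=" for a b c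
    using lin(1) by (auto dest: transD)
  have tot: "(a, b) \<in> r\<^sup>= \<or> (b, a) \<in> r\<^sup>=" if "a \<in> M" "b \<in> M" for a b
    using lin(2) that by (auto simp: total_on_def)
  have "{z \<in> M. (p, z) \<in> r\<^sup>= \<and> (z, q) \<in> r\<^sup>=} \<subseteq> closed_between M r p x \<union> closed_between M r q y"
  proof
    fix z assume "z \<in> {z \<in> M. (p, z) \<in> r\<^sup>= \<and> (z, q) \<in> r\<^sup>=}"
    then have z: "z \<in> M" "(p, z) \<in> r\<^sup>=" "(z, q) \<in> r\<^sup>=" by auto
    from tot[OF z(1) xy(1)] show "z \<in> closed_between M r p x \<union> closed_between M r q y"
    proof
      assume "(z, x) \<in> r\<^sup>="
      then show ?thesis using z unfolding closed_between_def by blast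
    next
      assume "(x, z) \<in> r\<^sup>="
      then have "(y, z) \<in> r\<^sup>=" using le tr by blast
      then show ?thesis using z unfolding closed_between_def by blast
    qed
  qed
  then show False using fin inf by (meson finite_UnI finite_subset)
qed

text \<open>A finite interval would put \<open>q\<close> into the block of \<open>p\<close>, and
  comparing the blocks would give \<open>(q, q) \<in> r\<close>.\<close>

lemma infinite_interval_of_block_less:
  assumes lin: "trans r" "irrefl r" and M: "p \<in> M" "q \<in> M"
    and less: "block_less r (block M r p) (block M r q)"
  shows "infinite {z \<in> M. (p, z) \<in> r \<and> (z, q) \<in> r}"
proof -
  have fin: "finite (closed_between M r x x)" if "x \<in> M" for x
  proof (rule finite_subset)
    show "closed_between M r x x \<subseteq> {x}"
      using lin by (auto simp: closed_between_def irrefl_def dest: transD)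
  qed simp
  then have self: "p \<in> block M r p" "q \<in> block M r q" using M by (auto simp: block_def)
  then have pq: "(p, q) \<in> r" using less by (auto simp: block_less_def)
  show "infinite {z \<in> M. (p, z) \<in> r \<and> (z, q) \<in> r}"
  proof
    assume fin: "finite {z \<in> M. (p, z) \<in> r \<and> (z, q) \<in> r}"
    have "closed_between M r p q \<subseteq> {p, q} \<union> {z \<in> M. (p, z) \<in> r \<and> (z, q) \<in> r}"
      using pq lin by (auto simp: closed_between_def irrefl_def dest: transD)
    then have "finite (closed_between M r p q)" by (rule finite_subset) (use fin in simp)
    then have "q \<in> block M r p" using M by (simp add: block_def)
    then have "(q, q) \<in> r" using less self by (auto simp: block_less_def)
    then show False using lin(2) by (auto simp: irrefl_def)
  qed
qed


section \<open>The cohesive power as a linear order\<close>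

locale cohesive_order =
  fixes L :: "nat set" and r :: "nat rel" and C :: "nat set"
  assumes linear_order: "computable_linear_order L r"
    and cohesive: "cohesive C"
begin

abbreviation "cpower \<equiv> cohesive_power C L"
abbreviation "lt \<equiv> cp_less C L r"
abbreviation "functions \<equiv> cp_functions C L"
abbreviation "cls \<equiv> cp_class C L"

lemma order: "computable_rel r" "r \<subseteq> L \<times> L" "strict_linear_order_on L r"
    "trans r" "irrefl r" "total_on L r"
  using linear_order by (auto simp: computable_linear_order_def strict_linear_order_on_def)

lemma infinite_C: "infinite C"
  using cohesive by (simp add: cohesive_def)

lemma cls_in_power: "\<phi> \<in> functions \<Longrightarrow> cls \<phi> \<in> cpower"
  by (auto simp: cohesive_power_def cp_class_def quotient_def)

lemma powerE:
  assumes "z \<in> cpower"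
  obtains \<phi> where "\<phi> \<in> functions" "z = cls \<phi>"
  using assms by (auto simp: cohesive_power_def cp_class_def quotient_def)

lemma less_in_power: "(y, z) \<in> lt \<Longrightarrow> y \<in> cpower \<and> z \<in> cpower"
  by (auto simp: cp_less_def intro: cls_in_power)

lemma irrefl_less: "irrefl lt"
proof (rule irreflI, rule notI)
  fix z assume z: "(z, z) \<in> lt"
  then obtain \<phi> where \<phi>: "\<phi> \<in> functions" "z = cls \<phi>" using less_in_power powerE by metis
  with z have "C \<subseteq>* {x. \<exists>a b. \<phi> x = Some a \<and> \<phi> x = Some b \<and> (a, b) \<in> r}"
    using cp_less_iff by blast
  then have "C \<subseteq>* {}"
    by (rule almost_subset_mono) (use order(5) in \<open>auto simp: irrefl_def\<close>)
  then show False using infinite_C by (simp add: almost_subset_def)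
qed

lemma trans_less: "trans lt"
proof (rule transI)
  fix w y z assume wy: "(w, y) \<in> lt" and yz: "(y, z) \<in> lt"
  obtain \<phi> \<psi> \<chi> where f: "\<phi> \<in> functions" "w = cls \<phi>" "\<psi> \<in> functions" "y = cls \<psi>"
    "\<chi> \<in> functions" "z = cls \<chi>"
    using less_in_power[OF wy] less_in_power[OF yz] by (auto elim!: powerE)
  have "C \<subseteq>* {x. \<exists>a b. \<phi> x = Some a \<and> \<psi> x = Some b \<and> (a, b) \<in> r}"
    and "C \<subseteq>* {x. \<exists>a b. \<psi> x = Some a \<and> \<chi> x = Some b \<and> (a, b) \<in> r}"
    using wy yz f cp_less_iff by blast+
  then have "C \<subseteq>* {x. \<exists>a b. \<phi> x = Some a \<and> \<chi> x = Some b \<and> (a, b) \<in> r}"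
    by (rule almost_subset_Int_mono) (use order(4) in \<open>auto dest: transD\<close>)
  then show "(w, z) \<in> lt" using f cp_less_iff by blast
qed

lemma ce_less:
  assumes "\<phi> \<in> functions" "\<psi> \<in> functions"
  shows "ce_set {x. \<exists>a b. \<phi> x = Some a \<and> \<psi> x = Some b \<and> (a, b) \<in> r}"
proof -
  have pc: "partial_computable \<phi>" "partial_computable \<psi>"
    using assms by (auto simp: cp_functions_def)
  have "semidecidable 2 (\<lambda>xs. \<exists>b. \<phi> (xs ! 0) = Some (xs ! 1) \<and> \<psi> (xs ! 0) = Some b
      \<and> (xs ! 1, b) \<in> r)"
    by (intro semidecidable_intros semidecidable_decidable computable_rel_decidable pc order(1)
          total_computable_tl total_computable_nth) simp_all
  from ce_set_semidecidable[OF this] show ?thesis by simp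
qed

text \<open>Almost all of \<open>C\<close> is covered by three c.e. sets, on which the values are
  less, greater or equal. One of them meets \<open>C\<close> infinitely often, so by cohesiveness
  contains almost all of it, and it is not the third since the classes differ.\<close>

lemma total_less: "total_on cpower lt"
proof (rule total_onI)
  fix y z assume yz: "y \<in> cpower" "z \<in> cpower" "y \<noteq> z"
  obtain \<phi> \<psi> where f: "\<phi> \<in> functions" "y = cls \<phi>" "\<psi> \<in> functions" "z = cls \<psi>"
    using yz by (auto elim!: powerE)
  let ?D = "\<lambda>\<phi> \<psi>. {x. \<exists>a b. \<phi> x = Some a \<and> \<psi> x = Some b \<and> (a, b) \<in> r}"
  let ?E = "{x. \<exists>a. \<phi> x = Some a \<and> \<psi> x = Some a}"
  have pc: "partial_computable \<phi>" "partial_computable \<psi>" and ran: "ran \<phi> \<subseteq> L" "ran \<psi> \<subseteq> L"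
    and dom: "C \<subseteq>* dom \<phi>" "C \<subseteq>* dom \<psi>"
    using f by (auto simp: cp_functions_def)
  have "semidecidable 2 (\<lambda>xs. \<phi> (xs ! 0) = Some (xs ! 1) \<and> \<psi> (xs ! 0) = Some (xs ! 1))"
    by (intro semidecidable_intros pc total_computable_nth) simp_all
  from ce_set_semidecidable[OF this] have ceE: "ce_set ?E" by simp
  have "\<phi> x = Some a \<Longrightarrow> \<psi> x = Some b \<Longrightarrow> (a, b) \<in> r \<or> (b, a) \<in> r \<or> a = b" for x a b
    using ran order(6) by (auto simp: total_on_def ran_def)
  then have "dom \<phi> \<inter> dom \<psi> \<subseteq> ?D \<phi> \<psi> \<union> ?D \<psi> \<phi> \<union> ?E" by blast
  with dom have "C \<subseteq>* ?D \<phi> \<psi> \<union> ?D \<psi> \<phi> \<union> ?E" by (rule almost_subset_Int_mono)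
  then have fin: "finite (C - (?D \<phi> \<psi> \<union> ?D \<psi> \<phi> \<union> ?E))" by (simp add: almost_subset_def)
  have "infinite (C \<inter> ?D \<phi> \<psi>) \<or> infinite (C \<inter> ?D \<psi> \<phi>) \<or> infinite (C \<inter> ?E)"
  proof (rule ccontr)
    assume "\<not> ?thesis"
    then have "finite ((C \<inter> ?D \<phi> \<psi>) \<union> (C \<inter> ?D \<psi> \<phi>) \<union> (C \<inter> ?E) \<union>
        (C - (?D \<phi> \<psi> \<union> ?D \<psi> \<phi> \<union> ?E)))"
      using fin by simp
    then have "finite C" by (rule rev_finite_subset) blast
    then show False using infinite_C by simp
  qed
  then have "C \<subseteq>* ?D \<phi> \<psi> \<or> C \<subseteq>* ?D \<psi> \<phi> \<or> C \<subseteq>* ?E"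
    using cohesive_ce_cases[OF cohesive] ce_less f(1,3) ceE by blast
  moreover have "\<not> C \<subseteq>* ?E"
  proof
    assume "C \<subseteq>* ?E"
    then have "(\<phi>, \<psi>) \<in> cp_eq C L" using f by (simp add: cp_eq_def)
    then have "y = z" using f equiv_class_eq[OF equiv_cp_eq] by (simp add: cp_class_def)
    then show False using yz(3) by simp
  qed
  ultimately show "(y, z) \<in> lt \<or> (z, y) \<in> lt" using f cp_less_iff by blast
qed


section \<open>Elements at infinite distance\<close>

text \<open>The pointwise counterpart of lying in different blocks, with \<open>\<phi>\<close> on
  the lower side; each level is a c.e. condition on \<open>x\<close>.\<close>

definition far :: "(nat \<rightharpoonup> nat) \<Rightarrow> (nat \<rightharpoonup> nat) \<Rightarrow> bool" where
  "far \<phi> \<psi> \<longleftrightarrow> \<phi> \<in> functions \<and> \<psi> \<in> functions \<and>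
     (\<forall>k. C \<subseteq>* {x. \<exists>u v. \<phi> x = Some u \<and> \<psi> x = Some v \<and> many_between r k u v})"

lemma far_less:
  assumes "far \<phi> \<psi>"
  shows "(cls \<phi>, cls \<psi>) \<in> lt"
proof -
  have "C \<subseteq>* {x. \<exists>u v. \<phi> x = Some u \<and> \<psi> x = Some v \<and> many_between r (Suc 0) u v}"
    using assms by (simp add: far_def)
  then have "C \<subseteq>* {x. \<exists>u v. \<phi> x = Some u \<and> \<psi> x = Some v \<and> (u, v) \<in> r}"
    by (rule almost_subset_mono) (use many_between_less[OF order(4)] in blast)
  then show ?thesis using assms cp_less_iff by (simp add: far_def)
qed

text \<open>Finitely many order relations between representatives hold simultaneously at almost all
  points of \<open>C\<close>, so \<open>k + 1\<close> classes between the two ends yield as many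
  distinct values between \<open>\<phi> x\<close> and \<open>\<psi> x\<close>.\<close>

lemma far_if_infinite_interval:
  assumes f: "\<phi> \<in> functions" "\<psi> \<in> functions"
    and inf: "infinite {z \<in> cpower. (cls \<phi>, z) \<in> lt \<and> (z, cls \<psi>) \<in> lt}"
  shows "far \<phi> \<psi>"
proof -
  let ?D = "\<lambda>\<phi> \<psi>. {x. \<exists>a b. \<phi> x = Some a \<and> \<psi> x = Some b \<and> (a, b) \<in> r}"
  have "C \<subseteq>* {x. \<exists>u v. \<phi> x = Some u \<and> \<psi> x = Some v \<and> many_between r k u v}" for k
  proof -
    \<comment> \<open>One class more than \<open>k\<close>: \<open>S\<close> is then nonempty even
      for \<open>k = 0\<close>, and a member of it guarantees that \<open>\<phi> x\<close> and
      \<open>\<psi> x\<close> are defined.\<close>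
    obtain S where S: "finite S" "card S = Suc k"
      "S \<subseteq> {z \<in> cpower. (cls \<phi>, z) \<in> lt \<and> (z, cls \<psi>) \<in> lt}"
      using infinite_arbitrarily_large[OF inf] by blast
    then have "\<forall>z\<in>S. \<exists>\<chi>. \<chi> \<in> functions \<and> cls \<chi> = z" by (auto elim!: powerE)
    then obtain h where "\<forall>z\<in>S. h z \<in> functions \<and> cls (h z) = z" by (rule bchoice[THEN exE])
    then have h: "\<And>z. z \<in> S \<Longrightarrow> h z \<in> functions" "\<And>z. z \<in> S \<Longrightarrow> cls (h z) = z" by auto
    define P where "P = {(y, z) \<in> S \<times> S. (y, z) \<in> lt}"
    have finP: "finite P"
      by (rule finite_subset[of _ "S \<times> S"]) (use S(1) in \<open>auto simp: P_def\<close>)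
    have D: "C \<subseteq>* ?D \<alpha> \<beta>" if "\<alpha> \<in> functions" "\<beta> \<in> functions" "(cls \<alpha>, cls \<beta>) \<in> lt" for \<alpha> \<beta>
      using cp_less_iff[OF that(1,2)] that(3) by simp
    have 1: "C \<subseteq>* (\<Inter>z\<in>S. ?D \<phi> (h z))"
      by (rule almost_subset_INT[OF S(1)], rule D) (use h S(3) f in auto)
    have 2: "C \<subseteq>* (\<Inter>z\<in>S. ?D (h z) \<psi>)"
      by (rule almost_subset_INT[OF S(1)], rule D) (use h S(3) f in auto)
    have 3: "C \<subseteq>* (\<Inter>p\<in>P. ?D (h (fst p)) (h (snd p)))"
    proof (rule almost_subset_INT[OF finP])
      fix p assume "p \<in> P"
      then obtain y z where "p = (y, z)" "y \<in> S" "z \<in> S" "(y, z) \<in> lt" by (auto simp: P_def)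
      then show "C \<subseteq>* ?D (h (fst p)) (h (snd p))"
        using D[of "h y" "h z"] h by simp
    qed
    have 4: "C \<subseteq>* (\<Inter>z\<in>S. ?D \<phi> (h z)) \<inter> (\<Inter>z\<in>S. ?D (h z) \<psi>)"
      using 1 2 by (rule almost_subset_Int_mono) simp
    show ?thesis
    proof (rule almost_subset_Int_mono[OF 4 3], rule subsetI)
      fix x assume x: "x \<in> (\<Inter>z\<in>S. ?D \<phi> (h z)) \<inter> (\<Inter>z\<in>S. ?D (h z) \<psi>) \<inter>
        (\<Inter>p\<in>P. ?D (h (fst p)) (h (snd p)))"
      obtain z0 where "z0 \<in> S" using S(2) by fastforce
      then obtain u v where uv: "\<phi> x = Some u" "\<psi> x = Some v" using x by blast
      let ?g = "\<lambda>z. the (h z x)"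
      have bounds: "(u, ?g z) \<in> r \<and> (?g z, v) \<in> r" if "z \<in> S" for z
      proof -
        have "x \<in> ?D \<phi> (h z)" "x \<in> ?D (h z) \<psi>" using x that by blast+
        then show ?thesis using uv by auto
      qed
      have step: "?g y \<noteq> ?g z" if "y \<in> S" "z \<in> S" "(y, z) \<in> lt" for y z
      proof -
        have "(y, z) \<in> P" using that by (simp add: P_def)
        then have "x \<in> ?D (h y) (h z)" using x by fastforce
        then have "(?g y, ?g z) \<in> r" by auto
        then show ?thesis using order(5) by (auto simp: irrefl_def)
      qed
      have "inj_on ?g S"
      proof (rule inj_onI, rule ccontr)
        fix y z assume yz: "y \<in> S" "z \<in> S" "?g y = ?g z" "y \<noteq> z"
        then have "(y, z) \<in> lt \<or> (z, y) \<in> lt"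
          using total_less S(3) unfolding total_on_def by blast
        then show False using step yz(1-3) by metis
      qed
      then have "card (?g ` S) = Suc k" using S(2) by (simp add: card_image)
      then have "many_between r k u v"
        by (intro many_betweenI[of "?g ` S"]) (use S(1) bounds in auto)
      then show "x \<in> {x. \<exists>u v. \<phi> x = Some u \<and> \<psi> x = Some v \<and> many_between r k u v}"
        using uv by blast
    qed
  qed
  then show ?thesis using f by (simp add: far_def)
qed

text \<open>Saturation is applied to the conditions that a value has at least \<open>k\<close>
  elements between it and either end; a median meets level \<open>k\<close> wherever the interval
  has \<open>2 * k + 1\<close> elements.\<close>

lemma far_dense:
  assumes co: "co_ce C" and far: "far \<phi> \<psi>"
  shows "\<exists>\<theta>. far \<phi> \<theta> \<and> far \<theta> \<psi>"
proof -
  \<comment> \<open>The two plain inequalities matter at level 0, where \<open>many_between\<close>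
    is vacuous: they force every value of the selected function into \<open>L\<close>.\<close>
  define Q where "Q x k a \<longleftrightarrow> (\<exists>u v. \<phi> x = Some u \<and> \<psi> x = Some v \<and> (u, a) \<in> r \<and> (a, v) \<in> r \<and>
    many_between r k u a \<and> many_between r k a v)" for x k a
  have f: "\<phi> \<in> functions" "\<psi> \<in> functions" using far by (auto simp: far_def)
  then have pc: "partial_computable \<phi>" "partial_computable \<psi>" by (auto simp: cp_functions_def)
  have "semidecidable 3 (\<lambda>xs. Q (xs ! 0) (xs ! 1) (xs ! 2))"
    unfolding Q_def
    by (intro semidecidable_intros semidecidable_decidable[OF computable_rel_decidable]
          semidecidable_many_between pc order(1) total_computable_tl total_computable_nth) simp_all
  moreover have "Q x k a" if "Q x (Suc k) a" for x k a
    using that many_between_mono[of r "Suc k" _ _ k] unfolding Q_def by (meson le_SucI le_refl)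
  moreover have "C \<subseteq>* {x. \<exists>a. Q x k a}" for k
  proof (rule almost_subset_mono)
    show "C \<subseteq>* {x. \<exists>u v. \<phi> x = Some u \<and> \<psi> x = Some v \<and> many_between r (2 * k + 1) u v}"
      using far unfolding far_def by blast
    show "\<dots> \<subseteq> {x. \<exists>a. Q x k a}"
      using many_between_middle[OF order(3,2)] unfolding Q_def by blast
  qed
  ultimately obtain \<theta> where \<theta>: "partial_computable \<theta>" "\<And>x a. \<theta> x = Some a \<Longrightarrow> Q x 0 a"
    "\<And>k. C \<subseteq>* {x. \<exists>a. \<theta> x = Some a \<and> Q x k a}"
    using cohesive_saturation[OF co cohesive, of Q] by blast
  have "ran \<theta> \<subseteq> L"
    using \<theta>(2) order(2) by (fastforce simp: ran_def Q_def)
  moreover have "C \<subseteq>* dom \<theta>"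
    using \<theta>(3)[of 0] by (rule almost_subset_mono) blast
  ultimately have "\<theta> \<in> functions" using \<theta>(1) by (simp add: cp_functions_def)
  moreover have "C \<subseteq>* {x. \<exists>u v. \<phi> x = Some u \<and> \<theta> x = Some v \<and> many_between r k u v}" for k
    using \<theta>(3)[of k] by (rule almost_subset_mono) (auto simp: Q_def)
  moreover have "C \<subseteq>* {x. \<exists>u v. \<theta> x = Some u \<and> \<psi> x = Some v \<and> many_between r k u v}" for k
    using \<theta>(3)[of k] by (rule almost_subset_mono) (auto simp: Q_def)
  ultimately show ?thesis using f unfolding far_def by blast
qed

text \<open>By density, the elements far above \<open>\<phi>\<close> and not above \<open>\<psi>\<close> have no least element.\<close>

lemma infinite_interval_if_far:
  assumes "co_ce C" "far \<phi> \<psi>"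
  shows "infinite {z \<in> cpower. (cls \<phi>, z) \<in> lt\<^sup>= \<and> (z, cls \<psi>) \<in> lt\<^sup>=}" (is "infinite ?I")
proof
  assume "finite ?I"
  define S where "S = {cls \<chi> | \<chi>. far \<phi> \<chi> \<and> (cls \<chi>, cls \<psi>) \<in> lt\<^sup>=}"
  have "S \<subseteq> ?I"
    unfolding S_def using far_less by (auto simp: far_def intro: cls_in_power)
  then have "finite S" using \<open>finite ?I\<close> by (rule finite_subset)
  have "cls \<psi> \<in> S" using assms(2) by (auto simp: S_def)
  have smaller: "\<exists>y\<in>S. (y, z) \<in> lt" if z: "z \<in> S" for z
  proof -
    obtain \<chi> where \<chi>: "z = cls \<chi>" "far \<phi> \<chi>" "(cls \<chi>, cls \<psi>) \<in> lt\<^sup>="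
      using z unfolding S_def by blast
    obtain \<theta> where \<theta>: "far \<phi> \<theta>" "far \<theta> \<chi>" using far_dense[OF assms(1) \<chi>(2)] by blast
    have \<theta>z: "(cls \<theta>, z) \<in> lt" using far_less[OF \<theta>(2)] \<chi>(1) by simp
    from \<chi>(3) have "(cls \<theta>, cls \<psi>) \<in> lt"
    proof
      assume "(cls \<chi>, cls \<psi>) \<in> lt"
      then show ?thesis using transD[OF trans_less \<theta>z] \<chi>(1) by simp
    qed (use \<theta>z \<chi>(1) in simp)
    with \<theta>(1) have "cls \<theta> \<in> S" unfolding S_def by blast
    with \<theta>z show ?thesis by blast
  qed
  \<comment> \<open>On a finite \<open>S\<close> the strict order is well-founded and gives a
    minimal element, against \<open>smaller\<close>.\<close>
  have "wf (Restr lt S)"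
  proof (rule finite_acyclic_wf)
    show "finite (Restr lt S)" using \<open>finite S\<close> by simp
    have "acyclic lt" using trans_less irrefl_less by (simp add: acyclic_irrefl)
    then show "acyclic (Restr lt S)" by (rule acyclic_subset) blast
  qed
  then obtain z where z: "z \<in> S" "\<forall>y. (y, z) \<in> Restr lt S \<longrightarrow> y \<notin> S"
    using \<open>cls \<psi> \<in> S\<close> unfolding wf_eq_minimal by blast
  obtain y where "y \<in> S" "(y, z) \<in> lt" using smaller[OF z(1)] by blast
  with z show False by blast
qed

lemma block_less_if_far:
  assumes "co_ce C" "far \<phi> \<psi>"
  shows "block_less lt (block cpower lt (cls \<phi>)) (block cpower lt (cls \<psi>))"
  by (rule block_less_block[OF trans_less total_less _ _ infinite_interval_if_far[OF assms]])
     (use assms(2) cls_in_power in \<open>auto simp: far_def\<close>)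

end

theorem theorem3p9:
  fixes L :: "nat set" and r :: "nat rel" and C :: "nat set"
  assumes "computable_linear_order L r"
    and "co_ce C" and "cohesive C"
  shows "dense_on (finite_condensation (cohesive_power C L) (cp_less C L r))
           (block_less (cp_less C L r))"
  unfolding dense_on_def
proof (intro ballI impI)
  interpret cohesive_order L r C by unfold_locales (use assms in auto)
  fix I J
  assume "I \<in> finite_condensation cpower lt" "J \<in> finite_condensation cpower lt"
    and IJ: "block_less lt I J"
  then obtain \<phi> \<psi> where f: "\<phi> \<in> functions" "I = block cpower lt (cls \<phi>)"
      "\<psi> \<in> functions" "J = block cpower lt (cls \<psi>)"
    by (auto simp: finite_condensation_def elim!: powerE)
  have "infinite {z \<in> cpower. (cls \<phi>, z) \<in> lt \<and> (z, cls \<psi>) \<in> lt}"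
    using infinite_interval_of_block_less[OF trans_less irrefl_less] f IJ cls_in_power by simp
  then have "far \<phi> \<psi>" by (rule far_if_infinite_interval[OF f(1,3)])
  then obtain \<theta> where \<theta>: "far \<phi> \<theta>" "far \<theta> \<psi>" using far_dense[OF assms(2)] by blast
  let ?K = "block cpower lt (cls \<theta>)"
  have "?K \<in> finite_condensation cpower lt"
    using \<theta>(1) cls_in_power by (simp add: finite_condensation_def far_def)
  moreover have "block_less lt I ?K" "block_less lt ?K J"
    using block_less_if_far[OF assms(2)] \<theta> f by simp_all
  ultimately show "\<exists>K\<in>finite_condensation cpower lt. block_less lt I K \<and> block_less lt K J"
    by blast
qed

end
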